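(* Let $d\ge2$, $\Omega=\{0,1\}^{\mathbb{Z}^d}$, let $\mathbb{P}$ be the Bernoulli product measure with $\mathbb{P}(\sigma_0=1)=1/2$, and let $\mathbb{Q}$ be a stationary and ergodic Gibbs measure on $\Omega$, and assume the rate distortion function $\mathcal{R}(\varepsilon)=\mathcal{R}(\mathbb{Q},\mathbb{P},\varepsilon)$ is strictly positive on $[0,\varepsilon_0)$. Then for $\alpha\in(0,1)$ and $\varepsilon>0$ small enough with $\varepsilon/\alpha<\varepsilon_0$, there exist constants $\Lambda_1,\Lambda_2,C,c,K\in(0,\infty)$ and, for each $n$-pattern $A_n$, a number $\Lambda(A_n)\in[\Lambda_1,\Lambda_2]$ such that for every $t>0$, every $n\ge1$ and $\mathbb{Q}$-almost every $\omega$ (without requiring $\omega_{C_n}$ to be $(\varepsilon,\alpha)$-good), $$\left|\mathbb{P}\left(\mathbf{T}_{[\omega_{C_n}]^\varepsilon}>\frac{t}{\Lambda_n\,\mathbb{P}([\omega_{C_n}]^\varepsilon)}\right)-e^{-t}\right|\le C e^{-ct}e^{-Kn^d},\qquad \Lambda_n=\Lambda(\omega_{C_n}).$$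
   Context: For finite $V\subseteq\mathbb{Z}^d$, $\Delta(V,\eta,\sigma)=\sum_{x\in V}|\eta_x-\sigma_x|$. $C_n=[0,n]^d\cap\mathbb{Z}^d$. An $n$-pattern is a map $A_n:C_n\to\{0,1\}$, and $[A_n]^\varepsilon=\{\omega\in\Omega:\Delta(C_n,\omega,A_n)\le\varepsilon|C_n|\}$. Approximate hitting time: $\mathbf{T}_{[A_n]^\varepsilon}(\sigma)=\min\{|C_k|:k>0,\ \exists x\in\mathbb{Z}^d,\ C_n+x\subseteq C_k,\text{ and the restriction of }\sigma\text{ to }C_n+x\text{, translated to }C_n\text{, lies in }[A_n]^\varepsilon\}$. An $n$-pattern $A_n$ is $(\varepsilon,\alpha)$-good if $[A_n]^\varepsilon$ and its translate by $x$ are disjoint for all $0<|x|\le\alpha n$. Rate distortion function: $\mathcal{R}(\mathbb{Q},\mathbb{P},\varepsilon)=\lim_n\inf_{\mathbb{J}_n}\frac{1}{|C_n|}H(\mathbb{J}_n\|\mathbb{Q}_n\times\mathbb{P}_n)$, infimum over joint distributions $\mathbb{J}_n$ on $\{0,1\}^{C_n}\times\{0,1\}^{C_n}$ with first marginal $\mathbb{Q}_n$ (the $C_n$-marginal of $\mathbb{Q}$) and $\int\frac{\Delta(C_n,\omega,\sigma)}{|C_n|}d\mathbb{J}_n\le\varepsilon$; $H$ is relative entropy. *)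

theory Defs
  imports "HOL-Probability.Probability"
begin

text \<open>Sites of Z^d are functions 'd => int for a finite index type 'd (d = CARD('d)).
  Configurations are maps from sites to bool (1 = True, 0 = False).\<close>

type_synonym 'd site = "'d \<Rightarrow> int"
type_synonym 'd config = "'d site \<Rightarrow> bool"

definition vadd :: "'d site \<Rightarrow> 'd site \<Rightarrow> 'd site" where
  "vadd x y = (\<lambda>i. x i + y i)"

definition shift :: "'d site \<Rightarrow> 'd config \<Rightarrow> 'd config" where
  "shift x \<sigma> = (\<lambda>y. \<sigma> (vadd y x))"

definition Omega :: "'d config measure" where
  "Omega = PiM UNIV (\<lambda>_. count_space UNIV)"

definition bernoulli_field :: "'d config measure" where
  "bernoulli_field = PiM UNIV (\<lambda>_. measure_pmf (bernoulli_pmf (1/2)))"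

definition cube :: "nat \<Rightarrow> 'd::finite site set" where
  "cube n = {x. \<forall>i. 0 \<le> x i \<and> x i \<le> int n}"

definition Delta :: "'d site set \<Rightarrow> 'd config \<Rightarrow> 'd config \<Rightarrow> real" where
  "Delta V \<eta> \<sigma> = (\<Sum>x\<in>V. if \<eta> x = \<sigma> x then 0 else 1)"

text \<open>n-patterns: maps C_n -> {0,1}, represented as configurations that are 0 off C_n.\<close>
definition patterns :: "nat \<Rightarrow> 'd::finite config set" where
  "patterns n = {a. \<forall>x. x \<notin> cube n \<longrightarrow> a x = False}"

definition restr :: "nat \<Rightarrow> 'd::finite config \<Rightarrow> 'd config" where
  "restr n \<omega> = (\<lambda>x. if x \<in> cube n then \<omega> x else False)"

definition approx_set :: "nat \<Rightarrow> real \<Rightarrow> 'd::finite config \<Rightarrow> 'd config set" where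
  "approx_set n \<epsilon> A = {\<omega>. Delta (cube n) \<omega> A \<le> \<epsilon> * real (card (cube n :: 'd site set))}"

text \<open>Approximate hitting time (value infinity if the set is never hit).\<close>
definition hit_time :: "nat \<Rightarrow> real \<Rightarrow> 'd::finite config \<Rightarrow> 'd config \<Rightarrow> ereal" where
  "hit_time n \<epsilon> A \<sigma> = Inf {ereal (real (card (cube k :: 'd site set))) | k. k > 0 \<and>
      (\<exists>x. vadd x ` cube n \<subseteq> cube k \<and> shift x \<sigma> \<in> approx_set n \<epsilon> A)}"

definition potential :: "('d::finite site set \<Rightarrow> 'd config \<Rightarrow> real) \<Rightarrow> bool" where
  "potential \<Phi> \<longleftrightarrow>
     (\<forall>A \<sigma> \<tau>. finite A \<longrightarrow> (\<forall>x\<in>A. \<sigma> x = \<tau> x) \<longrightarrow> \<Phi> A \<sigma> = \<Phi> A \<tau>) \<and>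
     (\<forall>A x \<sigma>. finite A \<longrightarrow> \<Phi> (vadd x ` A) \<sigma> = \<Phi> A (shift x \<sigma>)) \<and>
     (\<exists>b. (\<forall>A \<sigma>. \<bar>\<Phi> A \<sigma>\<bar> \<le> b A) \<and> b summable_on {A. finite A \<and> (\<lambda>_. 0) \<in> A})"

definition hamiltonian :: "('d::finite site set \<Rightarrow> 'd config \<Rightarrow> real) \<Rightarrow> 'd site set \<Rightarrow> 'd config \<Rightarrow> real" where
  "hamiltonian \<Phi> L \<sigma> = (\<Sum>\<^sub>\<infinity>A\<in>{A. finite A \<and> A \<inter> L \<noteq> {}}. \<Phi> A \<sigma>)"

definition splice :: "'d site set \<Rightarrow> 'd config \<Rightarrow> 'd config \<Rightarrow> 'd config" where
  "splice L \<eta> \<omega> = (\<lambda>x. if x \<in> L then \<eta> x else \<omega> x)"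

definition configs_on :: "'d site set \<Rightarrow> 'd config set" where
  "configs_on L = {\<eta>. \<forall>x. x \<notin> L \<longrightarrow> \<eta> x = False}"

definition gibbs_kernel ::
  "('d::finite site set \<Rightarrow> 'd config \<Rightarrow> real) \<Rightarrow> 'd site set \<Rightarrow> 'd config set \<Rightarrow> 'd config \<Rightarrow> real" where
  "gibbs_kernel \<Phi> L B \<omega> =
     (\<Sum>\<eta>\<in>configs_on L. indicator B (splice L \<eta> \<omega>) * exp (- hamiltonian \<Phi> L (splice L \<eta> \<omega>)))
     / (\<Sum>\<eta>\<in>configs_on L. exp (- hamiltonian \<Phi> L (splice L \<eta> \<omega>)))"

definition gibbs_measure :: "('d::finite site set \<Rightarrow> 'd config \<Rightarrow> real) \<Rightarrow> 'd config measure \<Rightarrow> bool" where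
  "gibbs_measure \<Phi> Q \<longleftrightarrow> prob_space Q \<and> sets Q = sets Omega \<and> potential \<Phi> \<and>
     (\<forall>L B. finite L \<longrightarrow> B \<in> sets Omega \<longrightarrow> measure Q B = (\<integral>\<omega>. gibbs_kernel \<Phi> L B \<omega> \<partial>Q))"

definition is_gibbs :: "'d::finite config measure \<Rightarrow> bool" where
  "is_gibbs Q \<longleftrightarrow> (\<exists>\<Phi>. gibbs_measure \<Phi> Q)"

definition stationary :: "'d config measure \<Rightarrow> bool" where
  "stationary Q \<longleftrightarrow> (\<forall>x. distr Q Omega (shift x) = Q)"

definition ergodic :: "'d config measure \<Rightarrow> bool" where
  "ergodic Q \<longleftrightarrow> (\<forall>A\<in>sets Omega. (\<forall>x. shift x -` A = A) \<longrightarrow> measure Q A = 0 \<or> measure Q A = 1)"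

definition marg :: "'d::finite config measure \<Rightarrow> nat \<Rightarrow> 'd config \<Rightarrow> real" where
  "marg M n a = measure M {\<omega> \<in> space M. \<forall>x\<in>cube n. \<omega> x = a x}"

definition admissible_joint ::
  "'d::finite config measure \<Rightarrow> real \<Rightarrow> nat \<Rightarrow> ('d config \<times> 'd config \<Rightarrow> real) \<Rightarrow> bool" where
  "admissible_joint Q \<epsilon> n J \<longleftrightarrow>
     (\<forall>p. J p \<ge> 0) \<and>
     (\<forall>p. p \<notin> patterns n \<times> patterns n \<longrightarrow> J p = 0) \<and>
     (\<forall>a\<in>patterns n. (\<Sum>b\<in>patterns n. J (a, b)) = marg Q n a) \<and>
     (\<Sum>p\<in>patterns n \<times> patterns n. J p * (Delta (cube n) (fst p) (snd p) / real (card (cube n :: 'd site set)))) \<le> \<epsilon>"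

definition rel_entropy ::
  "'d::finite config measure \<Rightarrow> 'd config measure \<Rightarrow> nat \<Rightarrow> ('d config \<times> 'd config \<Rightarrow> real) \<Rightarrow> real" where
  "rel_entropy Q P n J =
     (\<Sum>p\<in>patterns n \<times> patterns n.
        if J p = 0 then 0 else J p * ln (J p / (marg Q n (fst p) * marg P n (snd p))))"

text \<open>The n-th term of the sequence whose limit is R(Q,P,eps).\<close>
definition rate_distortion_n :: "'d::finite config measure \<Rightarrow> 'd config measure \<Rightarrow> real \<Rightarrow> nat \<Rightarrow> real" where
  "rate_distortion_n Q P \<epsilon> n =
     Inf {rel_entropy Q P n J | J. admissible_joint Q \<epsilon> n J} / real (card (cube n :: 'd site set))"

end

theory Submission
  imports Defs "HOL-Real_Asymp.Real_Asymp"
begin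

text \<open>The estimate holds for every pattern \<open>A\<close>. Put \<open>d = CARD('d)\<close>, let \<open>N = (n + 1)\<^sup>d\<close> be the number of
  sites of the pattern and let \<open>p\<close> be the probability of an approximate occurrence at a given
  position; \<open>p\<close> is exponentially small in \<open>N\<close>. Choose a mesoscopic side \<open>L\<close>, also exponentially large
  in \<open>N\<close>, with \<open>L\<^sup>d * p \<le> 1/2\<close>, let \<open>g\<close> be the probability that no occurrence starts in a cube of side
  \<open>L\<close>, and define \<open>\<Lambda>\<close> by \<open>g = exp (- \<Lambda> * p * L\<^sup>d)\<close>. A large cube is tiled by such blocks separated by
  corridors of width \<open>n\<close>; distinct blocks are independent, and the corridors only contribute
  a relative error of order \<open>n / L\<close>, which gives the exponential law.

  The upper bound on \<open>\<Lambda>\<close> is the union bound. The lower bound is Bonferroni's inequality on a sublattice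
  of fixed spacing, and needs that occurrences do not cluster: given an occurrence, an
  overlapping translate brings in at least \<open>(n + 1)\<^sup>d\<^sup>-\<^sup>1 \<ge> n + 1\<close> new sites (this uses \<open>d \<ge> 2\<close>). Either few
  of these are mismatched, which is exponentially unlikely, or the mismatches on the overlap are
  well below the threshold, which is unlikely because Hamming balls of small relative radius grow
  geometrically with their radius.\<close>

section \<open>Local events under the Bernoulli field\<close>

text \<open>One implication suffices, since exchanging \<open>\<sigma>\<close> and
  \<open>\<tau>\<close> gives the other. This is measurability in the coordinates of
  \<open>V\<close>, phrased so that probabilities become finite counts.\<close>

definition depends_on :: "'d site set \<Rightarrow> 'd config set \<Rightarrow> bool" where
  "depends_on V F \<longleftrightarrow> (\<forall>\<sigma> \<tau>. (\<forall>x\<in>V. \<sigma> x = \<tau> x) \<longrightarrow> \<sigma> \<in> F \<longrightarrow> \<tau> \<in> F)"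

lemma depends_onD: "depends_on V F \<Longrightarrow> (\<And>x. x \<in> V \<Longrightarrow> \<sigma> x = \<tau> x) \<Longrightarrow> \<sigma> \<in> F \<longleftrightarrow> \<tau> \<in> F"
  unfolding depends_on_def by metis

lemma depends_on_mono: "depends_on V F \<Longrightarrow> V \<subseteq> W \<Longrightarrow> depends_on W F"
  unfolding depends_on_def by blast

lemma depends_on_Int: "depends_on V F \<Longrightarrow> depends_on V G \<Longrightarrow> depends_on V (F \<inter> G)"
  unfolding depends_on_def by blast

lemma space_bernoulli_field [simp]: "space bernoulli_field = UNIV"
  by (simp add: bernoulli_field_def space_PiM PiE_UNIV_domain)

interpretation bernoulli: prob_space "bernoulli_field :: 'd config measure"
  unfolding bernoulli_field_def by (intro prob_space_PiM measure_pmf.prob_space_axioms)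

lemma cylinder:
  assumes "finite V"
  shows "{\<sigma>. \<forall>x\<in>V. \<sigma> x = a x} \<in> sets bernoulli_field"
    and "measure bernoulli_field {\<sigma>. \<forall>x\<in>V. \<sigma> x = a x} = (1/2) ^ card V"
proof -
  interpret product_prob_space "\<lambda>_::'a site. measure_pmf (bernoulli_pmf (1/2))" UNIV
    by unfold_locales
  have eq: "{\<sigma>. \<forall>x\<in>V. \<sigma> x = a x}
     = prod_emb UNIV (\<lambda>_. measure_pmf (bernoulli_pmf (1/2))) V (PiE V (\<lambda>x. {a x}))"
    by (auto simp: prod_emb_def PiE_iff space_PiM PiE_UNIV_domain fun_eq_iff extensional_def restrict_def)
  show "{\<sigma>. \<forall>x\<in>V. \<sigma> x = a x} \<in> sets bernoulli_field"
    unfolding eq bernoulli_field_def using assms by (intro sets_PiM_I) auto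
  have pm: "pmf (bernoulli_pmf (1/2)) b = 1/2" for b by (cases b) auto
  show "measure bernoulli_field {\<sigma>. \<forall>x\<in>V. \<sigma> x = a x} = (1/2) ^ card V"
    unfolding eq bernoulli_field_def using assms
    by (subst measure_PiM_emb) (auto simp: measure_pmf_single pm)
qed

text \<open>The event is a disjoint union of cylinders, one for each admissible subset
  \<open>S\<close> of \<open>V\<close> read as the set of ones, and each has probability
  \<open>(1/2) ^ card V\<close>.\<close>

lemma local_event:
  assumes V: "finite V" and F: "depends_on V F"
  shows sets_local_event: "F \<in> sets bernoulli_field"
    and measure_local_event:
      "measure bernoulli_field F = card {S \<in> Pow V. (\<lambda>x. x \<in> S) \<in> F} / 2 ^ card V"
proof -
  define \<C> where "\<C> = {S \<in> Pow V. (\<lambda>x. x \<in> S) \<in> F}"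
  define cyl where "cyl S = {\<sigma>. \<forall>x\<in>V. \<sigma> x = (x \<in> S)}" for S
  have fin: "finite \<C>" using V by (simp add: \<C>_def)
  have F_eq: "F = (\<Union>S\<in>\<C>. cyl S)"
  proof (intro set_eqI iffI)
    fix \<sigma> assume "\<sigma> \<in> F"
    then have "{x\<in>V. \<sigma> x} \<in> \<C>" 
      using depends_onD[OF F, of \<sigma> "\<lambda>x. x \<in> {x\<in>V. \<sigma> x}"] by (auto simp: \<C>_def)
    moreover have "\<sigma> \<in> cyl {x\<in>V. \<sigma> x}" by (simp add: cyl_def)
    ultimately show "\<sigma> \<in> (\<Union>S\<in>\<C>. cyl S)" by blast
  next
    fix \<sigma> assume "\<sigma> \<in> (\<Union>S\<in>\<C>. cyl S)"
    then obtain S where "S \<in> \<C>" "\<sigma> \<in> cyl S" by blast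
    then show "\<sigma> \<in> F"
      using depends_onD[OF F, of \<sigma> "\<lambda>x. x \<in> S"] by (auto simp: \<C>_def cyl_def)
  qed
  have disj: "disjoint_family_on cyl \<C>"
    by (auto simp: disjoint_family_on_def cyl_def \<C>_def)
  have cs: "cyl S \<in> sets bernoulli_field" for S
    unfolding cyl_def by (rule cylinder[OF V])
  then show "F \<in> sets bernoulli_field" unfolding F_eq using fin by blast
  have "measure bernoulli_field F = (\<Sum>S\<in>\<C>. measure bernoulli_field (cyl S))"
    unfolding F_eq using fin disj cs
    by (intro measure_finite_Union) auto
  also have "\<dots> = (\<Sum>S\<in>\<C>. (1/2) ^ card V)" unfolding cyl_def by (simp add: cylinder[OF V])
  finally show "measure bernoulli_field F = card {S \<in> Pow V. (\<lambda>x. x \<in> S) \<in> F} / 2 ^ card V"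
    by (simp add: \<C>_def power_divide)
qed

text \<open>Independence by counting: taking unions of \<open>S\<close> and \<open>T\<close> is a
  bijection onto the subsets of \<open>V \<union> W\<close> that realize both events, with inverse
  given by intersecting with \<open>V\<close> and \<open>W\<close>.\<close>

lemma measure_Int_local_events:
  assumes V: "finite V" "depends_on V F" and W: "finite W" "depends_on W G" and "V \<inter> W = {}"
  shows "measure bernoulli_field (F \<inter> G) = measure bernoulli_field F * measure bernoulli_field G"
proof -
  define \<A> where "\<A> = {S \<in> Pow V. (\<lambda>x. x \<in> S) \<in> F}"
  define \<B> where "\<B> = {S \<in> Pow W. (\<lambda>x. x \<in> S) \<in> G}"
  define \<C> where "\<C> = {S \<in> Pow (V \<union> W). (\<lambda>x. x \<in> S) \<in> F \<inter> G}"
  have FG: "depends_on (V \<union> W) (F \<inter> G)"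
    using V W by (blast intro: depends_on_Int depends_on_mono)
  have "\<C> = (\<lambda>(S, T). S \<union> T) ` (\<A> \<times> \<B>)"
  proof (intro set_eqI iffI)
    fix S assume S: "S \<in> \<C>"
    have "S \<inter> V \<in> \<A>" using S depends_onD[OF V(2), of "\<lambda>x. x \<in> S" "\<lambda>x. x \<in> S \<inter> V"]
      by (auto simp: \<A>_def \<C>_def)
    moreover have "S \<inter> W \<in> \<B>" using S depends_onD[OF W(2), of "\<lambda>x. x \<in> S" "\<lambda>x. x \<in> S \<inter> W"]
      by (auto simp: \<B>_def \<C>_def)
    moreover have "S = (S \<inter> V) \<union> (S \<inter> W)" using S by (auto simp: \<C>_def)
    ultimately show "S \<in> (\<lambda>(S, T). S \<union> T) ` (\<A> \<times> \<B>)" by (auto intro!: image_eqI[of _ _ "(S \<inter> V, S \<inter> W)"])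
  next
    fix U assume "U \<in> (\<lambda>(S, T). S \<union> T) ` (\<A> \<times> \<B>)"
    then obtain S T where U: "U = S \<union> T" "S \<in> \<A>" "T \<in> \<B>" by auto
    have "(\<lambda>x. x \<in> U) \<in> F" using U assms(5) depends_onD[OF V(2), of "\<lambda>x. x \<in> S" "\<lambda>x. x \<in> U"]
      by (auto simp: \<A>_def \<B>_def)
    moreover have "(\<lambda>x. x \<in> U) \<in> G" using U assms(5) depends_onD[OF W(2), of "\<lambda>x. x \<in> T" "\<lambda>x. x \<in> U"]
      by (auto simp: \<A>_def \<B>_def)
    ultimately show "U \<in> \<C>" using U by (auto simp: \<A>_def \<B>_def \<C>_def)
  qed
  moreover have "inj_on (\<lambda>(S, T). S \<union> T) (\<A> \<times> \<B>)"
  proof (rule inj_on_inverseI)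
    fix q assume "q \<in> \<A> \<times> \<B>"
    then show "(\<lambda>U. (U \<inter> V, U \<inter> W)) (case q of (S, T) \<Rightarrow> S \<union> T) = q"
      using assms(5) by (auto simp: \<A>_def \<B>_def)
  qed
  ultimately have "card \<C> = card \<A> * card \<B>"
    by (simp add: card_image card_cartesian_product)
  then show ?thesis
    using measure_local_event[OF _ FG] measure_local_event[OF V] measure_local_event[OF W] V W assms(5)
    by (simp add: \<A>_def \<B>_def \<C>_def card_Un_disjoint power_add)
qed

section \<open>Translation invariance\<close>

lemma vadd_commute: "vadd x y = vadd y x"
  by (simp add: vadd_def add.commute)

lemma inj_vadd: "inj (vadd x)"
  by (auto simp: inj_def vadd_def fun_eq_iff)

lemma shift_shift: "shift x (shift y \<sigma>) = shift (vadd x y) \<sigma>"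
  by (simp add: shift_def vadd_def add.assoc)

lemma depends_on_shift: 
  assumes "depends_on V F" shows "depends_on (vadd x ` V) (shift x -` F)"
  using depends_onD[OF assms]
  unfolding depends_on_def by (metis (no_types, lifting) image_eqI shift_def vadd_commute vimage_eq)

lemma measure_shift_local_event:
  assumes V: "finite V" "depends_on V F"
  shows "measure bernoulli_field (shift x -` F) = measure bernoulli_field F"
proof -
  have sh: "shift x (\<lambda>y. y \<in> vadd x ` S) = (\<lambda>y. y \<in> S)" for S
    by (auto simp: shift_def vadd_commute[of _ x] inj_image_mem_iff[OF inj_vadd])
  have "{S \<in> Pow (vadd x ` V). (\<lambda>y. y \<in> S) \<in> shift x -` F}
      = (`) (vadd x) ` {S \<in> Pow V. (\<lambda>y. y \<in> S) \<in> F}"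
    by (auto simp: subset_image_iff sh)
  moreover have "inj_on ((`) (vadd x)) A" for A
    by (auto simp: inj_on_def inj_image_eq_iff[OF inj_vadd])
  ultimately have "card {S \<in> Pow (vadd x ` V). (\<lambda>y. y \<in> S) \<in> shift x -` F}
      = card {S \<in> Pow V. (\<lambda>y. y \<in> S) \<in> F}"
    by (simp add: card_image)
  then show ?thesis
    using V measure_local_event[OF _ depends_on_shift[OF V(2)], of x] measure_local_event[OF V]
    by (simp add: card_image[OF inj_on_subset[OF inj_vadd]])
qed

section \<open>Hamming balls\<close>

definition mismatches :: "'d site set \<Rightarrow> 'd config \<Rightarrow> 'd config \<Rightarrow> nat" where
  "mismatches V \<sigma> A = card {x \<in> V. \<sigma> x \<noteq> A x}"

lemma Delta_eq_mismatches: "finite V \<Longrightarrow> Delta V \<sigma> A = mismatches V \<sigma> A"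
  by (simp add: Delta_def mismatches_def sum.If_cases Int_def)

lemma mismatches_cong: "(\<And>x. x \<in> V \<Longrightarrow> \<sigma> x = \<tau> x) \<Longrightarrow> mismatches V \<sigma> A = mismatches V \<tau> A"
  unfolding mismatches_def by (rule arg_cong[of _ _ card]) auto

lemma depends_on_mismatches: "depends_on V {\<sigma>. P (mismatches V \<sigma> A)}"
  unfolding depends_on_def 
proof (intro allI impI)
  fix \<sigma> \<tau> :: "'a config"
  assume "\<forall>x\<in>V. \<sigma> x = \<tau> x" "\<sigma> \<in> {\<sigma>. P (mismatches V \<sigma> A)}"
  then show "\<tau> \<in> {\<sigma>. P (mismatches V \<sigma> A)}"
    using mismatches_cong[of V \<sigma> \<tau> A] by simp
qed

lemma mismatches_Un:
  "finite V \<Longrightarrow> finite W \<Longrightarrow> V \<inter> W = {} \<Longrightarrow>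
    mismatches (V \<union> W) \<sigma> A = mismatches V \<sigma> A + mismatches W \<sigma> A"
proof -
  assume *: "finite V" "finite W" "V \<inter> W = {}"
  have "{x \<in> V \<union> W. \<sigma> x \<noteq> A x} = {x \<in> V. \<sigma> x \<noteq> A x} \<union> {x \<in> W. \<sigma> x \<noteq> A x}" by auto
  moreover have "{x \<in> V. \<sigma> x \<noteq> A x} \<inter> {x \<in> W. \<sigma> x \<noteq> A x} = {}" using * by auto
  ultimately show ?thesis using * by (simp add: mismatches_def card_Un_disjoint)
qed

text \<open>Moves the translation from the configuration to the window and the pattern, so that an
  occurrence at \<open>x\<close> becomes a Hamming ball condition on its own window.\<close>

lemma mismatches_shift:
  "mismatches V (shift x \<sigma>) A = mismatches (vadd x ` V) \<sigma> (\<lambda>y. A (\<lambda>i. y i - x i))"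
proof -
  have "{y \<in> vadd x ` V. \<sigma> y \<noteq> A (\<lambda>i. y i - x i)} = vadd x ` {y \<in> V. shift x \<sigma> y \<noteq> A y}"
  proof -
    have "(\<lambda>i. vadd x y i - x i) = y" for y by (simp add: vadd_def)
    then have "\<sigma> (vadd x y) \<noteq> A (\<lambda>i. vadd x y i - x i) \<longleftrightarrow> shift x \<sigma> y \<noteq> A y" for y
      by (simp only: shift_def vadd_commute[of y x])
    then show ?thesis by blast
  qed
  then have "mismatches (vadd x ` V) \<sigma> (\<lambda>y. A (\<lambda>i. y i - x i)) = card (vadd x ` {y \<in> V. shift x \<sigma> y \<noteq> A y})"
    unfolding mismatches_def by (rule arg_cong)
  also have "\<dots> = mismatches V (shift x \<sigma>) A"
    unfolding mismatches_def by (rule card_image[OF inj_on_subset[OF inj_vadd]]) simp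
  finally show ?thesis ..
qed

text \<open>Cardinality of a Hamming ball of radius \<open>k\<close> among the binary words of
  length \<open>M\<close>.\<close>

definition ball_volume :: "nat \<Rightarrow> nat \<Rightarrow> nat" where
  "ball_volume M k = (\<Sum>j\<le>k. M choose j)"

text \<open>Flipping the coordinates where \<open>A\<close> is 1 is an involution,
  \<open>\<phi>\<close>, carrying the ball around \<open>A\<close> to the ball around 0; the volume
  does not depend on the centre.\<close>

lemma measure_mismatches_le:
  assumes "finite V"
  shows "measure bernoulli_field {\<sigma>. mismatches V \<sigma> A \<le> k} = ball_volume (card V) k / 2 ^ card V"
proof -
  define \<phi> where "\<phi> S = {x\<in>V. (x \<in> S) \<noteq> A x}" for S
  have inv: "\<phi> (\<phi> S) = S" if "S \<subseteq> V" for S using that by (auto simp: \<phi>_def)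
  have m: "mismatches V (\<lambda>x. x \<in> S) A = card (\<phi> S)" for S by (simp add: mismatches_def \<phi>_def)
  have sub: "\<phi> S \<subseteq> V" for S by (auto simp: \<phi>_def)
  have "bij_betw \<phi> {S \<in> Pow V. (\<lambda>x. x \<in> S) \<in> {\<sigma>. mismatches V \<sigma> A \<le> k}} {S \<in> Pow V. card S \<le> k}"
    by (rule bij_betwI[where g = \<phi>]) (simp_all add: m inv sub)
  then have "card {S \<in> Pow V. (\<lambda>x. x \<in> S) \<in> {\<sigma>. mismatches V \<sigma> A \<le> k}} = card {S \<in> Pow V. card S \<le> k}"
    by (rule bij_betw_same_card)
  also have "{S \<in> Pow V. card S \<le> k} = (\<Union>j\<le>k. {S. S \<subseteq> V \<and> card S = j})" by auto
  also have "card (\<Union>j\<le>k. {S. S \<subseteq> V \<and> card S = j}) = (\<Sum>j\<le>k. card {S. S \<subseteq> V \<and> card S = j})"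
    using assms by (intro card_UN_disjoint) auto
  also have "\<dots> = ball_volume (card V) k"
    unfolding ball_volume_def n_subsets[OF assms] ..
  finally show ?thesis
    unfolding measure_local_event[OF assms depends_on_mismatches[of V "\<lambda>j. j \<le> k" A]] by (rule arg_cong)
qed

text \<open>Terms with \<open>j \<le> k\<close> are enlarged by
  \<open>2 ^ k * (1/2) ^ j \<ge> 1\<close>; completing the sum gives the binomial expansion of
  \<open>(1 + 1/2) ^ M\<close>.\<close>

lemma ball_volume_chernoff: "real (ball_volume M k) \<le> 2 ^ k * (3/2) ^ M"
proof -
  have "real (ball_volume M k) \<le> (\<Sum>j\<le>k. 2 ^ k * (real (M choose j) * (1/2) ^ j))"
    unfolding ball_volume_def of_nat_sum
  proof (rule sum_mono)
    fix j assume "j \<in> {..k}"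
    then have "(2::real) ^ j \<le> 2 ^ k" by simp
    then have "1 \<le> 2 ^ k * (1/2::real) ^ j" by (simp add: power_divide field_simps)
    then have "real (M choose j) * 1 \<le> real (M choose j) * (2 ^ k * (1/2::real) ^ j)"
      by (intro mult_left_mono) auto
    then show "real (M choose j) \<le> 2 ^ k * (real (M choose j) * (1/2) ^ j)" by (simp add: mult_ac)
  qed
  also have "\<dots> = 2 ^ k * (\<Sum>j\<le>k. real (M choose j) * (1/2) ^ j)" by (simp add: sum_distrib_left)
  also have "(\<Sum>j\<le>k. real (M choose j) * (1/2) ^ j) \<le> (\<Sum>j\<le>max k M. real (M choose j) * (1/2) ^ j)"
    by (intro sum_mono2) auto
  also have "\<dots> = (\<Sum>j\<le>M. real (M choose j) * (1/2) ^ j)"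
    by (intro sum.mono_neutral_right) auto
  also have "\<dots> = (3/2) ^ M"
    using binomial_ring[of "1/2::real" 1 M] by simp
  finally show ?thesis by simp
qed

lemma measure_mismatches_chernoff:
  assumes "finite V"
  shows "measure bernoulli_field {\<sigma>. mismatches V \<sigma> A \<le> k} \<le> 2 ^ k * (3/4) ^ card V"
proof -
  have "ball_volume (card V) k / 2 ^ card V \<le> 2 ^ k * (3/2) ^ card V / 2 ^ card V"
    by (intro divide_right_mono ball_volume_chernoff) simp
  also have "\<dots> = 2 ^ k * ((3/2) / 2) ^ card V" unfolding power_divide[of "3/2"] by simp
  finally show ?thesis using measure_mismatches_le[OF assms] by simp
qed

text \<open>For \<open>j < r\<close> consecutive coefficients have ratio
  \<open>(M - j) / (j + 1) \<ge> c\<close>, so each unit taken off the radius divides the volume by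
  at least \<open>c\<close>.\<close>

lemma ball_volume_ratio:
  assumes "q \<le> r" "c * r + r \<le> M + 1"
  shows "c ^ q * ball_volume M (r - q) \<le> ball_volume M r"
  using assms(1)
proof (induction q)
  case (Suc q)
  define k where "k = r - Suc q"
  have k: "r - q = Suc k" "Suc k \<le> r" using Suc.prems by (auto simp: k_def)
  have "c * ball_volume M k \<le> (\<Sum>j\<le>k. M choose Suc j)"
    unfolding ball_volume_def sum_distrib_left
  proof (rule sum_mono)
    fix j assume "j \<in> {..k}"
    then have j: "Suc j \<le> r" using k by simp
    then have "c * Suc j \<le> c * r" by (intro mult_left_mono) auto
    then have "c * Suc j \<le> M - j" using assms(2) j by linarith
    then have "c * Suc j * (M choose j) \<le> (M - j) * (M choose j)" by (rule mult_right_mono) simp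
    also have "\<dots> = Suc j * (M choose Suc j)"
      using binomial_absorb_comp[of M j] binomial_absorption[of j M] by (metis)
    finally show "c * (M choose j) \<le> M choose Suc j"
      by (metis Suc_mult_le_cancel1 mult.assoc mult.commute)
  qed
  also have "\<dots> \<le> ball_volume M (Suc k)"
    unfolding ball_volume_def by (simp add: sum.atMost_Suc_shift del: sum.atMost_Suc)
  finally have "c ^ q * (c * ball_volume M k) \<le> c ^ q * ball_volume M (r - q)"
    unfolding k by (rule mult_left_mono) simp
  also have "\<dots> \<le> ball_volume M r" by (rule Suc.IH) (use Suc.prems in linarith)
  finally show ?case unfolding k_def power_Suc2 mult.assoc .
qed simp

section \<open>Overlapping occurrences\<close>

text \<open>Let \<open>W = V' - V\<close> and \<open>m = card W\<close>. An occurrence on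
  \<open>V'\<close> has either at most \<open>m div 4\<close> mismatches on \<open>W\<close>, an
  event independent of the first occurrence, or at least \<open>q\<close> there and hence at most
  \<open>r - q\<close> on the overlap. The second case is compared with the first occurrence through
  ball volumes on the overlap, which are the same for both patterns.\<close>

lemma measure_mismatches_pair_le:
  assumes fin: "finite V" "finite V'" and card_eq: "card V = card V'" and r: "1024 * r \<le> card V"
  shows "measure bernoulli_field ({\<sigma>. mismatches V \<sigma> A \<le> r} \<inter> {\<sigma>. mismatches V' \<sigma> A' \<le> r})
    \<le> 2 * (9/10) ^ card (V' - V) * measure bernoulli_field {\<sigma>. mismatches V \<sigma> A \<le> r}"
proof -
  define I W O' where "I = V - V'" and "W = V' - V" and "O' = V \<inter> V'"
  define m q where "m = card W" and "q = m div 4 + 1"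
  define E where "E = {\<sigma>. mismatches V \<sigma> A \<le> r}"
  define p where "p = measure bernoulli_field E"
  have fin': "finite I" "finite W" "finite O'" using fin by (auto simp: I_def W_def O'_def)
  have V_eq: "V = I \<union> O'" "V' = W \<union> O'" "I \<inter> O' = {}" "W \<inter> O' = {}" "V \<inter> W = {}"
    by (auto simp: I_def W_def O'_def)
  have cards: "card I + card O' = card V" "m + card O' = card V'"
    using card_Un_disjoint[OF fin'(1,3) V_eq(3)] card_Un_disjoint[OF fin'(2,3) V_eq(4)] 
    by (simp_all add: m_def flip: V_eq)
  then have card_I: "card I = m" using card_eq by simp
  have dep_E: "depends_on V E" unfolding E_def by (rule depends_on_mismatches)
  have sets_E: "E \<in> sets bernoulli_field" by (rule sets_local_event[OF fin(1) dep_E])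
  define F where "F = {\<sigma>. mismatches W \<sigma> A' \<le> m div 4}"
  have dep_F: "depends_on W F" unfolding F_def by (rule depends_on_mismatches)
  have sets_F: "F \<in> sets bernoulli_field" by (rule sets_local_event[OF fin'(2) dep_F])
  \<comment> \<open>The case \<open>q > r\<close> is separated because the truncated subtraction
    \<open>r - q\<close> would give radius 0 where no configuration qualifies.\<close>
  define G where "G = (if q \<le> r then {\<sigma>. mismatches O' \<sigma> A' \<le> r - q} else {})"
  have sets_G: "G \<in> sets bernoulli_field" unfolding G_def
    using sets_local_event[OF fin'(3) depends_on_mismatches[of O' "\<lambda>k. k \<le> r - q" A']] by simp
  have "E \<inter> {\<sigma>. mismatches V' \<sigma> A' \<le> r} \<subseteq> (E \<inter> F) \<union> G"
    using mismatches_Un[OF fin'(2,3) V_eq(4), of _ A']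
    by (auto simp: F_def G_def q_def simp flip: V_eq)
  then have "measure bernoulli_field (E \<inter> {\<sigma>. mismatches V' \<sigma> A' \<le> r})
      \<le> measure bernoulli_field ((E \<inter> F) \<union> G)"
    using sets_E sets_F sets_G by (intro bernoulli.finite_measure_mono) auto
  also have "\<dots> \<le> measure bernoulli_field (E \<inter> F) + measure bernoulli_field G"
    using sets_E sets_F sets_G by (intro measure_Un_le) auto
  also have "measure bernoulli_field (E \<inter> F) \<le> (9/10) ^ m * p"
  proof -
    have "measure bernoulli_field F \<le> 2 ^ (m div 4) * (3/4) ^ m" (is "_ \<le> ?u")
      unfolding F_def m_def by (rule measure_mismatches_chernoff[OF fin'(2)])
    \<comment> \<open>The fourth power removes the rounding in \<open>m div 4\<close>; what remains
      is \<open>2 * (3/4) ^ 4 \<le> (9/10) ^ 4\<close>.\<close>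
    also have "?u \<le> (9/10) ^ m"
    proof (rule power_le_imp_le_base)
      have "(2::real) ^ (m div 4 * 4) \<le> 2 ^ m" by (intro power_increasing) auto
      then have "?u ^ Suc 3 \<le> 2 ^ m * ((3/4) ^ m) ^ 4"
        by (simp add: power_mult_distrib power_mult[symmetric] del: power_Suc flip: numeral_eq_Suc)
      also have "\<dots> = (2 * (3/4) ^ 4) ^ m" 
        by (simp only: power_mult_distrib power_mult[symmetric] mult.commute)
      also have "\<dots> \<le> ((9/10) ^ 4) ^ m" by (intro power_mono) (auto simp: power_divide)
      also have "\<dots> = ((9/10) ^ m) ^ Suc 3" by (simp only: power_mult[symmetric] mult.commute) simp
      finally show "?u ^ Suc 3 \<le> ((9/10) ^ m) ^ Suc 3" .
    qed simp
    finally have "measure bernoulli_field F \<le> (9/10) ^ m" .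
    moreover have "measure bernoulli_field (E \<inter> F) = p * measure bernoulli_field F"
      unfolding p_def using measure_Int_local_events[OF fin(1) dep_E fin'(2) dep_F V_eq(5)] .
    ultimately show ?thesis by (simp add: p_def mult_left_mono mult.commute)
  qed
  also have "measure bernoulli_field G \<le> (9/10) ^ m * p"
  proof (cases "q \<le> r")
    case True
    have m_less: "m < 4 * q" by (simp add: q_def)
    have "measure bernoulli_field G = ball_volume (card O') (r - q) / 2 ^ card O'"
      using True measure_mismatches_le[OF fin'(3)] by (simp add: G_def)
    \<comment> \<open>Since \<open>m < 4 * q \<le> 4 * r\<close>, the overlap still has at least
      \<open>1020 * r\<close> sites, enough for the volume ratio 256. As \<open>256 = 2 ^ 8\<close>,
      the gain \<open>256 ^ q\<close> is at least \<open>2 ^ (2 * m)\<close>.\<close>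
    moreover have "256 ^ q * ball_volume (card O') (r - q) \<le> ball_volume (card O') r"
    proof (rule ball_volume_ratio[OF True])
      have "1024 * r \<le> m + card O'" "m < 4 * r" using r cards card_eq m_less True by simp_all
      then show "256 * r + r \<le> card O' + 1" by simp
    qed
    then have "real (256 ^ q * ball_volume (card O') (r - q)) \<le> ball_volume (card O') r"
      by (rule of_nat_mono)
    then have "256 ^ q * real (ball_volume (card O') (r - q)) \<le> ball_volume (card O') r"
      by simp
    ultimately have 1: "256 ^ q * measure bernoulli_field G \<le> ball_volume (card O') r / 2 ^ card O'"
      by (simp add: divide_right_mono)
    \<comment> \<open>A perfect match on \<open>I\<close> and at most \<open>r\<close> mismatches on
      the overlap force \<open>E\<close>. The match costs a factor \<open>2 ^ m\<close>, which
      leaves another \<open>2 ^ m\<close> of the gain.\<close>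
    define H where "H = {\<sigma>. mismatches I \<sigma> A \<le> 0}"
    define K where "K = {\<sigma>. mismatches O' \<sigma> A \<le> r}"
    have HK: "depends_on I H" "depends_on O' K" unfolding H_def K_def by (rule depends_on_mismatches)+
    have "measure bernoulli_field (H \<inter> K) \<le> p"
      unfolding p_def using sets_E mismatches_Un[OF fin'(1,3) V_eq(3), of _ A]
      by (intro bernoulli.finite_measure_mono) (auto simp: E_def H_def K_def simp flip: V_eq)
    moreover have "measure bernoulli_field (H \<inter> K) = measure bernoulli_field H * measure bernoulli_field K"
      using HK fin' V_eq(3) by (intro measure_Int_local_events)
    moreover have "measure bernoulli_field H = 1 / 2 ^ m"
      unfolding H_def measure_mismatches_le[OF fin'(1)] by (simp add: card_I ball_volume_def)
    ultimately have "ball_volume (card O') r / 2 ^ card O' \<le> 2 ^ m * p"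
      unfolding K_def measure_mismatches_le[OF fin'(3)] by (simp add: field_simps)
    with 1 have 2: "256 ^ q * measure bernoulli_field G \<le> 2 ^ m * p" by linarith
    have "(2::real) ^ m * 2 ^ m \<le> 256 ^ q"
    proof -
      have "(2::real) ^ (m + m) \<le> 2 ^ (8 * q)" using m_less by (intro power_increasing) auto
      also have "\<dots> = 256 ^ q" by (simp add: power_mult)
      finally show ?thesis by (simp add: power_add)
    qed
    then have "2 ^ m * 2 ^ m * measure bernoulli_field G \<le> 256 ^ q * measure bernoulli_field G"
      by (intro mult_right_mono) auto
    with 2 have "2 ^ m * (2 ^ m * measure bernoulli_field G) \<le> 2 ^ m * p"
      unfolding mult.assoc by (rule order_trans[rotated])
    then have "2 ^ m * measure bernoulli_field G \<le> p" by simp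
    then have "measure bernoulli_field G \<le> (1/2) ^ m * p" by (simp add: field_simps)
    also have "\<dots> \<le> (9/10) ^ m * p" by (intro mult_right_mono power_mono) (auto simp: p_def)
    finally show ?thesis .
  qed (simp add: G_def p_def)
  finally show ?thesis by (simp add: E_def p_def m_def W_def mult_ac)
qed

section \<open>Counting in boxes and translated cubes\<close>

text \<open>Half-open boxes serve as sets of positions: \<open>grid 0\<close> is empty, and side
  lengths multiply exactly under tiling.\<close>

definition grid :: "nat \<Rightarrow> 'd::finite site set" where
  "grid M = {x. \<forall>i. 0 \<le> x i \<and> x i < int M}"

lemma card_functions_into:
  assumes "\<And>i::'d::finite. finite (S i)" "\<And>i. card (S i) = k"
  shows "finite {x. \<forall>i. x i \<in> S i}" "card {x. \<forall>i. x i \<in> S i} = k ^ CARD('d)"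
proof -
  have "{x. \<forall>i. x i \<in> S i} = PiE UNIV S" by (auto simp: PiE_UNIV_domain)
  then show "finite {x. \<forall>i. x i \<in> S i}" "card {x. \<forall>i. x i \<in> S i} = k ^ CARD('d)"
    using assms by (auto simp: card_PiE intro: finite_PiE)
qed

lemma finite_grid: "finite (grid M :: 'd::finite site set)"
  and card_grid: "card (grid M :: 'd site set) = M ^ CARD('d)"
  using card_functions_into[of "\<lambda>_::'d. {0..<int M}" M] by (auto simp: grid_def)

lemma cube_eq_grid: "cube n = grid (Suc n)"
proof -
  have "0 \<le> t \<and> t \<le> int n \<longleftrightarrow> 0 \<le> t \<and> t < int (Suc n)" for t by auto
  then show ?thesis by (simp only: cube_def grid_def)
qed

lemma finite_cube: "finite (cube n :: 'd::finite site set)"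
  and card_cube: "card (cube n :: 'd site set) = (n + 1) ^ CARD('d)"
  by (simp_all add: cube_eq_grid finite_grid card_grid)

text \<open>In direction \<open>i\<close> take the face of the cube that the translation pushes out.
  A second coordinate \<open>j\<close>, available in dimension at least 2, runs along it and yields
  \<open>n + 1\<close> new sites.\<close>

lemma card_translate_diff_cube:
  fixes z :: "'d::finite site"
  assumes "CARD('d) \<ge> 2" "z i \<noteq> 0"
  shows "n + 1 \<le> card (vadd z ` cube n - cube n)"
proof -
  have "\<exists>j. j \<noteq> i"
  proof (rule ccontr)
    assume "\<nexists>j. j \<noteq> i"
    then have "(UNIV :: 'd set) = {i}" by auto
    then have "CARD('d) = card {i}" by simp
    with assms(1) show False by simp
  qed
  then obtain j where j: "j \<noteq> i" by blast
  define f where "f l k = (if k = i then (if z i > 0 then int n else 0) else if k = j then int l else 0)"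
    for l :: nat and k
  have "vadd z (f l) \<in> vadd z ` cube n - cube n" if "l \<le> n" for l
  proof -
    have "f l \<in> cube n" using that by (auto simp: f_def cube_def)
    moreover have "vadd z (f l) i < 0 \<or> vadd z (f l) i > int n"
      using assms(2) by (auto simp: vadd_def f_def)
    then have "vadd z (f l) \<notin> cube n" by (auto simp: cube_def not_le intro!: exI[of _ i])
    ultimately show ?thesis by blast
  qed
  then have "(\<lambda>l. vadd z (f l)) ` {..n} \<subseteq> vadd z ` cube n - cube n" by blast
  moreover have "inj_on (\<lambda>l. vadd z (f l)) {..n}"
  proof (rule inj_onI)
    fix l l' assume "vadd z (f l) = vadd z (f l')"
    then have "f l j = f l' j" using inj_vadd[of z] by (simp add: inj_eq)
    then show "l = l'" using j by (simp add: f_def)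
  qed
  ultimately show ?thesis
    using card_mono[of "vadd z ` cube n - cube n" "(\<lambda>l. vadd z (f l)) ` {..n}"]
    by (simp add: card_image finite_cube)
qed

lemma overlap_bound:
  fixes z :: "'d::finite site" and A :: "'d config"
  assumes "CARD('d) \<ge> 2" "z i \<noteq> 0" "1024 * r \<le> card (cube n :: 'd site set)"
  defines "E \<equiv> {\<sigma>. mismatches (cube n) \<sigma> A \<le> r}"
  shows "measure bernoulli_field (E \<inter> shift z -` E) \<le> 2 * (9/10) ^ (n + 1) * measure bernoulli_field E"
proof -
  have "measure bernoulli_field (E \<inter> shift z -` E) \<le>
      2 * (9/10) ^ card (vadd z ` cube n - cube n) * measure bernoulli_field E"
    using measure_mismatches_pair_le[of "cube n" "vadd z ` cube n" r A "\<lambda>y. A (\<lambda>i. y i - z i)"] assms(3)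
    by (simp add: E_def vimage_def mismatches_shift finite_cube card_image[OF inj_on_subset[OF inj_vadd]])
  also have "\<dots> \<le> 2 * (9/10) ^ (n + 1) * measure bernoulli_field E"
    using card_translate_diff_cube[of z i n, OF assms(1,2)]
    by (intro mult_right_mono mult_left_mono power_decreasing) auto
  finally show ?thesis .
qed

section \<open>Blocks and corridors\<close>

text \<open>Sup-norm distance greater than \<open>n\<close>, which makes the translates of
  \<open>cube n\<close> to \<open>x\<close> and \<open>y\<close> disjoint and occurrences there
  independent.\<close>

definition apart :: "nat \<Rightarrow> 'd site \<Rightarrow> 'd site \<Rightarrow> bool" where
  "apart n x y \<longleftrightarrow> (\<exists>i. \<bar>x i - y i\<bar> > int n)"

lemma not_apart_self: "\<not> apart n x x"
  by (simp add: apart_def)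

lemma apart_disjoint:
  assumes "apart n x y" shows "vadd x ` cube n \<inter> vadd y ` cube n = {}"
proof -
  obtain i where i: "\<bar>x i - y i\<bar> > int n" using assms by (auto simp: apart_def)
  have False if "a \<in> cube n" "b \<in> cube n" "vadd x a = vadd y b" for a b
  proof -
    have "x i + a i = y i + b i" using fun_cong[OF that(3), of i] by (simp add: vadd_def)
    moreover have "0 \<le> a i" "a i \<le> int n" "0 \<le> b i" "b i \<le> int n"
      using that(1,2) by (auto simp: cube_def)
    ultimately show False using i by linarith
  qed
  then show ?thesis by auto
qed

text \<open>The block geometry uses only that an occurrence is determined by the sites of
  \<open>cube n\<close>; the Hamming structure enters separately, through the overlap bound.\<close>

locale local_pattern =
  fixes n :: nat and E :: "'d::finite config set"
  assumes depends_on_E: "depends_on (cube n) E"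
begin

definition nohit :: "'d site set \<Rightarrow> 'd config set" where
  "nohit X = {\<sigma>. \<forall>x\<in>X. shift x \<sigma> \<notin> E}"

abbreviation "\<mu> \<equiv> measure (bernoulli_field :: 'd config measure)"

lemma depends_on_hit: "depends_on (vadd x ` cube n) (shift x -` E)"
  by (rule depends_on_shift[OF depends_on_E])

lemma sets_hit: "shift x -` E \<in> sets bernoulli_field"
  by (rule sets_local_event[OF _ depends_on_hit]) (simp add: finite_cube)

lemma measure_hit: "\<mu> (shift x -` E) = \<mu> E"
  by (rule measure_shift_local_event[OF finite_cube depends_on_E])

lemma depends_on_nohit: "depends_on (\<Union>x\<in>X. vadd x ` cube n) (nohit X)"
proof -
  have "\<tau> \<in> nohit X" if eq: "\<forall>y\<in>(\<Union>x\<in>X. vadd x ` cube n). \<sigma> y = \<tau> y" and \<sigma>: "\<sigma> \<in> nohit X" for \<sigma> \<tau>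
  proof -
    have "\<tau> \<notin> shift x -` E" if "x \<in> X" for x
      using depends_onD[OF depends_on_hit, of x \<sigma> \<tau>] eq \<sigma> that by (auto simp: nohit_def)
    then show ?thesis by (simp add: nohit_def)
  qed
  then show ?thesis unfolding depends_on_def by blast
qed

lemma finite_support: "finite X \<Longrightarrow> finite (\<Union>x\<in>X. vadd x ` cube n)"
  by (simp add: finite_cube)

lemma sets_nohit: "finite X \<Longrightarrow> nohit X \<in> sets bernoulli_field"
  by (rule sets_local_event[OF finite_support depends_on_nohit])

lemma nohit_Un: "nohit (X \<union> Y) = nohit X \<inter> nohit Y"
  by (auto simp: nohit_def)

lemma nohit_empty: "nohit {} = UNIV"
  by (simp add: nohit_def)

lemma nohit_antimono: "X \<subseteq> Y \<Longrightarrow> nohit Y \<subseteq> nohit X"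
  by (auto simp: nohit_def)

lemma measure_nohit_translate:
  assumes "finite X" shows "\<mu> (nohit (vadd u ` X)) = \<mu> (nohit X)"
proof -
  have "nohit (vadd u ` X) = shift u -` nohit X"
    by (simp add: nohit_def shift_shift vimage_def vadd_commute[of u])
  then show ?thesis
    using measure_shift_local_event[OF finite_support[OF assms] depends_on_nohit] by simp
qed

lemma support_disjoint:
  assumes "\<And>x y. x \<in> X \<Longrightarrow> y \<in> Y \<Longrightarrow> apart n x y"
  shows "(\<Union>x\<in>X. vadd x ` cube n) \<inter> (\<Union>y\<in>Y. vadd y ` cube n) = {}"
proof -
  have "vadd x ` cube n \<inter> vadd y ` cube n = {}" if "x \<in> X" "y \<in> Y" for x y
    using apart_disjoint[OF assms[OF that]] .
  then show ?thesis by blast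
qed

lemma measure_hit_Int_nohit:
  assumes "finite X" "\<And>x. x \<in> X \<Longrightarrow> apart n z x"
  shows "\<mu> (shift z -` E \<inter> nohit X) = \<mu> E * \<mu> (nohit X)"
  using measure_Int_local_events[OF _ depends_on_hit[of z] finite_support[OF assms(1)] depends_on_nohit]
    support_disjoint[of "{z}" X] assms(2) by (simp add: finite_cube measure_hit)

lemma measure_hit_Int_hit:
  assumes "apart n x y"
  shows "\<mu> (shift x -` E \<inter> shift y -` E) = \<mu> E * \<mu> E"
  using measure_Int_local_events[OF _ depends_on_hit[of x] _ depends_on_hit[of y] apart_disjoint[OF assms]]
  by (simp add: finite_cube measure_hit)

lemma measure_nohit_UN:
  assumes "finite J" "\<And>j. j \<in> J \<Longrightarrow> finite (B j)"
    and "\<And>j k x y. j \<in> J \<Longrightarrow> k \<in> J \<Longrightarrow> j \<noteq> k \<Longrightarrow> x \<in> B j \<Longrightarrow> y \<in> B k \<Longrightarrow> apart n x y"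
  shows "\<mu> (nohit (\<Union>j\<in>J. B j)) = (\<Prod>j\<in>J. \<mu> (nohit (B j)))"
  using assms
proof (induction J rule: finite_induct)
  case empty
  then show ?case using bernoulli.prob_space by (simp add: nohit_empty)
next
  case (insert j J)
  have "\<mu> (nohit (B j \<union> (\<Union>k\<in>J. B k))) = \<mu> (nohit (B j)) * \<mu> (nohit (\<Union>k\<in>J. B k))"
    unfolding nohit_Un
  proof (rule measure_Int_local_events[OF _ depends_on_nohit _ depends_on_nohit])
    show "finite (\<Union>x\<in>B j. vadd x ` cube n)" "finite (\<Union>x\<in>\<Union>k\<in>J. B k. vadd x ` cube n)"
      using insert.hyps(1) insert.prems(1) by (simp_all add: finite_cube)
    show "(\<Union>x\<in>B j. vadd x ` cube n) \<inter> (\<Union>x\<in>\<Union>k\<in>J. B k. vadd x ` cube n) = {}"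
    proof (rule support_disjoint)
      fix x y assume "x \<in> B j" "y \<in> (\<Union>k\<in>J. B k)"
      then obtain k where "k \<in> J" "y \<in> B k" "j \<noteq> k" using insert.hyps by blast
      then show "apart n x y" using insert.prems(2)[of j k x y] \<open>x \<in> B j\<close> by blast
    qed
  qed
  moreover have "\<mu> (nohit (\<Union>k\<in>J. B k)) = (\<Prod>j\<in>J. \<mu> (nohit (B j)))"
    using insert.prems by (intro insert.IH) blast+
  ultimately show ?case using insert.hyps by simp
qed

section \<open>Tiling a box by separated blocks\<close>

text \<open>The spacing \<open>L + n\<close> leaves corridors of width \<open>n\<close>, so
  positions in different blocks differ by at least \<open>n + 1\<close> in some coordinate.\<close>

definition block :: "nat \<Rightarrow> 'd site \<Rightarrow> 'd site set" where
  "block L j = vadd (\<lambda>i. int (L + n) * j i) ` grid L"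

lemma finite_block: "finite (block L j)"
  by (simp add: block_def finite_grid)

lemma blockD: "x \<in> block L j \<Longrightarrow> int (L + n) * j i \<le> x i \<and> x i < int (L + n) * j i + int L"
  by (auto simp: block_def grid_def vadd_def)

lemma measure_nohit_block: "\<mu> (nohit (block L j)) = \<mu> (nohit (grid L))"
  unfolding block_def by (rule measure_nohit_translate[OF finite_grid])

lemma apart_blocks:
  assumes "j \<noteq> k" "x \<in> block L j" "y \<in> block L k"
  shows "apart n x y"
proof -
  obtain i where i: "j i \<noteq> k i" using assms(1) by auto
  have *: "\<bar>x i - y i\<bar> > int n" 
    if "x \<in> block L j" "y \<in> block L k" "j i < k i" for x y j k
  proof -
    have "int (L + n) * (j i + 1) \<le> int (L + n) * k i" using that(3) by (intro mult_left_mono) auto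
    then show ?thesis using blockD[OF that(1), of i] blockD[OF that(2), of i] by (simp add: algebra_simps)
  qed
  show ?thesis
    using i *[OF assms(2,3)] *[OF assms(3,2)] unfolding apart_def
    by (metis abs_minus_commute linorder_neqE)
qed

lemma measure_nohit_blocks:
  assumes "finite J"
  shows "\<mu> (nohit (\<Union>j\<in>J. block L j)) = \<mu> (nohit (grid L)) ^ card J"
proof -
  have "\<mu> (nohit (\<Union>j\<in>J. block L j)) = (\<Prod>j\<in>J. \<mu> (nohit (block L j)))"
    using assms finite_block apart_blocks by (intro measure_nohit_UN) auto
  then show ?thesis by (simp add: measure_nohit_block)
qed

lemma blocks_subset_grid:
  assumes "m * (L + n) \<le> M" shows "(\<Union>j\<in>grid m. block L j) \<subseteq> grid M"
proof
  fix x assume "x \<in> (\<Union>j\<in>grid m. block L j)"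
  then obtain j where j: "j \<in> grid m" "x \<in> block L j" by blast
  have "0 \<le> x i \<and> x i < int M" for i
  proof -
    have "0 \<le> j i" "j i < int m" using j(1) unfolding grid_def by blast+
    then have ji: "0 \<le> j i" "j i + 1 \<le> int m" by simp_all
    have "int (L + n) * (j i + 1) \<le> int (L + n) * int m" using ji by (intro mult_left_mono) auto
    moreover have "int (L + n) * int m \<le> int M"
      using assms by (metis mult.commute of_nat_le_iff of_nat_mult)
    moreover have "0 \<le> int (L + n) * j i" using ji by simp
    ultimately show ?thesis using blockD[OF j(2), of i] by (simp add: algebra_simps)
  qed
  then show "x \<in> grid M" by (simp add: grid_def)
qed

lemma card_blocks: "card (\<Union>j\<in>grid m. block L j) = (m * L) ^ CARD('d)"
proof -
  have "card (\<Union>j\<in>grid m. block L j) = (\<Sum>j\<in>grid m. card (block L j))"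
    using apart_blocks not_apart_self by (intro card_UN_disjoint) (blast intro: finite_grid finite_block)+
  also have "\<dots> = (m * L) ^ CARD('d)"
    by (simp add: block_def card_image[OF inj_on_subset[OF inj_vadd]] card_grid power_mult_distrib)
  finally show ?thesis .
qed

text \<open>With \<open>q i = z i div (L + n)\<close>, blocks of index at most
  \<open>q i - 1\<close> end at least \<open>n + 1\<close> before \<open>z i\<close>, and those of
  index at least \<open>q i + 2\<close> start too far beyond it. Two indices per coordinate
  remain.\<close>

lemma card_near_blocks:
  assumes "L \<ge> 1"
  shows "card {j \<in> grid m. \<exists>x\<in>block L j. \<not> apart n z x} \<le> 2 ^ CARD('d)"
proof -
  define q where "q i = z i div int (L + n)" for i
  have sub: "{j \<in> grid m. \<exists>x\<in>block L j. \<not> apart n z x} \<subseteq> {j. \<forall>i. j i \<in> {q i, q i + 1}}"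
  proof (intro subsetI CollectI allI)
    fix j i assume "j \<in> {j \<in> grid m. \<exists>x\<in>block L j. \<not> apart n z x}"
    then obtain x where x: "x \<in> block L j" "\<not> apart n z x" by blast
    have zx: "\<bar>z i - x i\<bar> \<le> int n" using x(2) by (auto simp: apart_def not_less)
    define w where "w = int (L + n)"
    have w: "w > 0" "w = int L + int n" using assms by (simp_all add: w_def)
    have z: "z i = w * q i + z i mod w" by (simp add: q_def w_def)
    have zm: "0 \<le> z i mod w" "z i mod w < w" using w by simp_all
    have x1: "w * j i \<le> x i" "x i < w * j i + int L"
      using blockD[OF x(1), of i] by (simp_all add: w_def)
    have "w * j i < w * q i + w * 2" using z zm zx x1 w(2) by linarith
    then have "j i < q i + 2" using w(1) by (simp flip: distrib_left)
    have "w * q i - w < w * j i" using z zm zx x1 w(2) by linarith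
    then have "w * (q i - 1) < w * j i" by (simp add: right_diff_distrib)
    then have "q i - 1 < j i" using w(1) by simp
    with \<open>j i < q i + 2\<close> show "j i \<in> {q i, q i + 1}" by auto
  qed
  have fin: "finite {j. \<forall>i::'d. j i \<in> {q i, q i + 1}}"
    and card: "card {j. \<forall>i::'d. j i \<in> {q i, q i + 1}} = 2 ^ CARD('d)"
    by (rule card_functions_into; simp)+
  show ?thesis using card_mono[OF fin sub] unfolding card .
qed

lemma measure_nohit_grid_le:
  assumes "m * (L + n) \<le> M"
  shows "\<mu> (nohit (grid M)) \<le> \<mu> (nohit (grid L)) ^ (m ^ CARD('d))"
proof -
  have "\<mu> (nohit (grid M)) \<le> \<mu> (nohit (\<Union>j\<in>grid m. block L j))"
    using blocks_subset_grid[OF assms]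
    by (intro bernoulli.finite_measure_mono nohit_antimono sets_nohit finite_UN_I)
      (auto simp: finite_grid finite_block)
  then show ?thesis by (simp add: measure_nohit_blocks finite_grid card_grid)
qed

text \<open>If the blocks are free of occurrences but the box is not, some position \<open>z\<close>
  outside the blocks carries one. Summing over \<open>z\<close> while keeping the blocks apart from
  \<open>z\<close> free gives an error proportional to the main term, not merely an additive
  one.\<close>

lemma measure_nohit_grid_ge:
  assumes M: "m * (L + n) \<le> M" and L: "L \<ge> 1" and g: "\<mu> (nohit (grid L)) > 0"
  shows "\<mu> (nohit (grid M)) \<ge> \<mu> (nohit (grid L)) ^ (m ^ CARD('d)) *
    (1 - (real M ^ CARD('d) - (real m * real L) ^ CARD('d)) * \<mu> E * (1 / \<mu> (nohit (grid L))) ^ (2 ^ CARD('d)))"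
proof -
  define g where "g = \<mu> (nohit (grid L))"
  define D where "D = m ^ CARD('d)"
  define e where "e = (2::nat) ^ CARD('d)"
  define B where "B = (\<Union>j\<in>grid m. block L j)"
  define Z where "Z = grid M - B"
  define J where "J z = {j \<in> grid m. \<forall>x\<in>block L j. apart n z x}" for z
  have g01: "0 < g" "g \<le> 1" using g by (auto simp: g_def)
  have finB: "finite B" unfolding B_def by (intro finite_UN_I finite_grid finite_block)
  have finJ: "finite (J z)" for z unfolding J_def by (simp add: finite_grid)
  have BM: "B \<subseteq> grid M" unfolding B_def by (rule blocks_subset_grid[OF M])
  have finZ: "finite Z" by (simp add: Z_def finite_grid)
  have cardZ: "real (card Z) = real M ^ CARD('d) - (real m * real L) ^ CARD('d)"
  proof -
    have "card Z + card B = card (grid M :: 'd site set)"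
      unfolding Z_def card_Diff_subset[OF finB BM] using card_mono[OF finite_grid BM] by simp
    then have "card Z + (m * L) ^ CARD('d) = M ^ CARD('d)" by (simp add: B_def card_blocks card_grid)
    then have "real (card Z + (m * L) ^ CARD('d)) = real (M ^ CARD('d))" by (rule arg_cong)
    then show ?thesis by simp
  qed
  \<comment> \<open>Blocks too close to \<open>z\<close> are dropped to make the hit at
    \<open>z\<close> independent of the others; there are at most \<open>e\<close> of them, which
    costs a factor \<open>(1 / g) ^ e\<close>.\<close>
  define H where "H z = shift z -` E \<inter> nohit (\<Union>j\<in>J z. block L j)" for z
  have sets_H: "H z \<in> sets bernoulli_field" for z
    unfolding H_def by (intro sets.Int sets_hit sets_nohit finite_UN_I finJ finite_block)
  have H_le: "\<mu> (H z) \<le> \<mu> E * (g ^ D * (1 / g) ^ e)" for z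
  proof -
    have "D \<le> card (J z) + e"
    proof -
      have "J z \<union> {j \<in> grid m. \<exists>x\<in>block L j. \<not> apart n z x} = grid m" by (auto simp: J_def)
      then have "D \<le> card (J z) + card {j \<in> grid m. \<exists>x\<in>block L j. \<not> apart n z x}"
        using card_Un_le[of "J z" "{j \<in> grid m. \<exists>x\<in>block L j. \<not> apart n z x}"]
        by (simp add: D_def card_grid)
      also have "\<dots> \<le> card (J z) + e" using card_near_blocks[OF L] by (simp add: e_def)
      finally show ?thesis .
    qed
    then have "g ^ (card (J z) + e) \<le> g ^ D" using g01 by (intro power_decreasing) auto
    then have "g ^ card (J z) \<le> g ^ D * (1 / g) ^ e"
      using g01 by (simp add: power_add power_divide pos_le_divide_eq)
    moreover have "\<mu> (H z) = \<mu> E * \<mu> (nohit (\<Union>j\<in>J z. block L j))"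
      unfolding H_def by (rule measure_hit_Int_nohit) (auto simp: J_def finJ[unfolded J_def] finite_block)
    moreover have "\<mu> (nohit (\<Union>j\<in>J z. block L j)) = g ^ card (J z)"
      unfolding g_def by (rule measure_nohit_blocks[OF finJ])
    ultimately show ?thesis by (simp add: mult_left_mono)
  qed
  have "nohit B \<subseteq> nohit (grid M) \<union> (\<Union>z\<in>Z. H z)"
    by (auto simp: nohit_def H_def Z_def J_def B_def)
  then have "\<mu> (nohit B) \<le> \<mu> (nohit (grid M) \<union> (\<Union>z\<in>Z. H z))"
    by (intro bernoulli.finite_measure_mono sets.Un sets_nohit finite_grid sets.finite_UN finZ sets_H)
  also have "\<dots> \<le> \<mu> (nohit (grid M)) + \<mu> (\<Union>z\<in>Z. H z)"
    by (intro measure_Un_le sets_nohit finite_grid sets.finite_UN finZ sets_H)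
  also have "\<mu> (\<Union>z\<in>Z. H z) \<le> (\<Sum>z\<in>Z. \<mu> (H z))"
    by (intro measure_UNION_le finZ sets_H)
  also have "\<dots> \<le> (\<Sum>z\<in>Z. \<mu> E * (g ^ D * (1 / g) ^ e))" by (intro sum_mono H_le)
  also have "\<dots> = card Z * (\<mu> E * (g ^ D * (1 / g) ^ e))" by simp
  finally have "g ^ D \<le> \<mu> (nohit (grid M)) + card Z * (\<mu> E * (g ^ D * (1 / g) ^ e))"
    unfolding B_def g_def D_def by (simp add: measure_nohit_blocks finite_grid card_grid)
  then show ?thesis
    unfolding cardZ by (simp add: g_def D_def e_def algebra_simps)
qed

end

section \<open>Probability of an occurrence in a block\<close>

text \<open>Inclusion-exclusion truncated after pairs; the double sum runs over ordered pairs, hence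
  the division by 2.\<close>

lemma (in prob_space) bonferroni_lower:
  assumes "finite I" "\<And>i. i \<in> I \<Longrightarrow> A i \<in> events"
  shows "(\<Sum>i\<in>I. prob (A i)) - (\<Sum>i\<in>I. \<Sum>j\<in>I. if i = j then 0 else prob (A i \<inter> A j)) / 2
    \<le> prob (\<Union>i\<in>I. A i)"
  using assms
proof (induction I rule: finite_induct)
  case (insert a I)
  define U where "U = (\<Union>i\<in>I. A i)"
  define P where "P i j = (if i = j then 0 else prob (A i \<inter> A j))" for i j
  have U: "U \<in> events" using insert.hyps(1) insert.prems by (simp add: U_def sets.finite_UN)
  have "prob (\<Union>i\<in>insert a I. A i) = prob (A a) + prob U - prob (A a \<inter> U)"
    using insert.prems U by (simp add: U_def[symmetric] measure_Un3 fmeasurable_eq_sets)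
  moreover have "prob (A a \<inter> U) \<le> (\<Sum>j\<in>I. P a j)"
  proof -
    have "prob (A a \<inter> U) \<le> (\<Sum>j\<in>I. prob (A a \<inter> A j))"
      unfolding U_def Int_UN_distrib using insert by (intro measure_UNION_le) auto
    also have "\<dots> = (\<Sum>j\<in>I. P a j)" using insert.hyps by (intro sum.cong) (auto simp: P_def)
    finally show ?thesis .
  qed
  moreover have "(\<Sum>i\<in>insert a I. \<Sum>j\<in>insert a I. P i j) = 2 * (\<Sum>j\<in>I. P a j) + (\<Sum>i\<in>I. \<Sum>j\<in>I. P i j)"
  proof -
    have "P a a = 0" "(\<Sum>i\<in>I. P i a) = (\<Sum>i\<in>I. P a i)"
      by (auto intro!: sum.cong simp: P_def Int_commute)
    then show ?thesis using insert.hyps by (simp add: sum.distrib)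
  qed
  moreover have "(\<Sum>i\<in>I. prob (A i)) - (\<Sum>i\<in>I. \<Sum>j\<in>I. P i j) / 2 \<le> prob U"
    unfolding P_def U_def by (rule insert.IH) (rule insert.prems, simp)
  ultimately show ?case using insert.hyps unfolding P_def[symmetric] by (simp add: field_simps)
qed simp

context local_pattern
begin

text \<open>By translation invariance only the difference of the positions matters, so an overlap
  bound at the origin suffices.\<close>

lemma measure_hit_Int_hit_eq:
  "\<mu> (shift x -` E \<inter> shift y -` E) = \<mu> (E \<inter> shift (\<lambda>i. y i - x i) -` E)"
proof -
  define z where "z = (\<lambda>i. y i - x i)"
  have "vadd z x = y" by (simp add: vadd_def z_def)
  then have "shift x -` E \<inter> shift y -` E = shift x -` (E \<inter> shift z -` E)"
    by (auto simp: shift_shift)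
  moreover have "depends_on (cube n \<union> vadd z ` cube n) (E \<inter> shift z -` E)"
    using depends_on_E depends_on_hit by (blast intro: depends_on_Int depends_on_mono)
  ultimately show ?thesis
    using measure_shift_local_event[of "cube n \<union> vadd z ` cube n" "E \<inter> shift z -` E" x]
    by (simp add: z_def finite_cube)
qed

lemma measure_nohit_union_bound:
  assumes "finite X" shows "1 - \<mu> (nohit X) \<le> card X * \<mu> E"
proof -
  have "1 - \<mu> (nohit X) = \<mu> (- nohit X)"
    using bernoulli.prob_compl[OF sets_nohit[OF assms]] by (simp add: Compl_eq_Diff_UNIV)
  also have "- nohit X = (\<Union>x\<in>X. shift x -` E)" by (auto simp: nohit_def)
  also have "\<mu> \<dots> \<le> (\<Sum>x\<in>X. \<mu> (shift x -` E))" by (intro measure_UNION_le assms sets_hit)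
  finally show ?thesis by (simp add: measure_hit)
qed

text \<open>Bonferroni on the positions of \<open>grid L\<close> with coordinates divisible by
  \<open>r\<close>. For each of them, pairs that are apart contribute at most
  \<open>card X * p * p \<le> p / 2\<close> and near pairs at most \<open>p / 2\<close>, so half of
  the first-order sum \<open>card X * p\<close> survives.\<close>

lemma hit_probability_ge:
  assumes overlap: "\<And>z i. z i \<noteq> 0 \<Longrightarrow> \<mu> (E \<inter> shift z -` E) \<le> b * \<mu> E"
    and b: "r \<le> n \<Longrightarrow> (2 * real n + 1) ^ CARD('d) * b \<le> 1/2" "b \<ge> 0"
    and L: "L \<ge> 1" "real L ^ CARD('d) * \<mu> E \<le> 1/2" and r: "r \<ge> 1"
  shows "(real L / real r) ^ CARD('d) * \<mu> E / 2 \<le> 1 - \<mu> (nohit (grid L))"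
proof -
  \<comment> \<open>The ceiling of \<open>L / r\<close>: the multiples \<open>r * j\<close> with
    \<open>j < K\<close> stay below \<open>L\<close>, and \<open>L \<le> r * K\<close>.\<close>
  define K where "K = (L - 1) div r + 1"
  define f :: "'d site \<Rightarrow> 'd site" where "f j = (\<lambda>i. int r * j i)" for j
  define X where "X = f ` grid K"
  define p where "p = \<mu> E"
  have inj: "inj f" using r by (auto simp: f_def inj_def fun_eq_iff)
  have finX: "finite X" by (simp add: X_def finite_grid)
  have rK: "r * (K - 1) \<le> L - 1" "L \<le> r * K"
  proof -
    show "r * (K - 1) \<le> L - 1" by (simp add: K_def)
    have "L - 1 = r * ((L - 1) div r) + (L - 1) mod r" by simp
    moreover have "(L - 1) mod r < r" using r by simp
    ultimately show "L \<le> r * K" unfolding K_def distrib_left using L(1) by linarith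
  qed
  have "K \<le> L" using rK(1) r L(1) div_le_dividend[of "L - 1" r] unfolding K_def by linarith
  have cX: "card X = K ^ CARD('d)" by (simp add: X_def card_image[OF inj_on_subset[OF inj]] card_grid)
  have "X \<subseteq> grid L"
  proof
    fix x assume "x \<in> X"
    then obtain j where j: "j \<in> grid K" "x = f j" by (auto simp: X_def)
    have "0 \<le> x i \<and> x i < int L" for i
    proof -
      have "0 \<le> j i" "j i < int K" using j(1) unfolding grid_def by blast+
      then have "0 \<le> j i" "j i \<le> int (K - 1)" by (auto simp: K_def)
      then have "int r * j i \<le> int r * int (K - 1)" "0 \<le> int r * j i" by (auto intro: mult_left_mono)
      moreover have "int r * int (K - 1) \<le> int (L - 1)" using rK(1) unfolding of_nat_mult[symmetric] by (rule of_nat_mono)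
      ultimately show ?thesis using L(1) by (simp add: j(2) f_def)
    qed
    then show "x \<in> grid L" by (simp add: grid_def)
  qed
  have near: "(\<Sum>y\<in>X. if x = y then 0 else \<mu> (shift x -` E \<inter> shift y -` E)) \<le> p"
    if x_in: "x \<in> X" for x
  proof -
    define Y where "Y = {y \<in> X. y \<noteq> x \<and> \<not> apart n x y}"
    have "(\<Sum>y\<in>X. if x = y then 0 else \<mu> (shift x -` E \<inter> shift y -` E))
        \<le> (\<Sum>y\<in>X. p * p + (if y \<in> Y then b * p else 0))"
    proof (rule sum_mono)
      fix y assume y: "y \<in> X"
      show "(if x = y then 0 else \<mu> (shift x -` E \<inter> shift y -` E)) \<le> p * p + (if y \<in> Y then b * p else 0)"
      proof (cases "x = y")
        case True
        then show ?thesis using b(2) by (simp add: p_def)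
      next
        case False
        show ?thesis
        proof (cases "apart n x y")
          case True
          then show ?thesis using False by (simp add: measure_hit_Int_hit p_def Y_def)
        next
          case near: False
          obtain i where "x i \<noteq> y i" using False by (auto simp: fun_eq_iff)
          then have "y i - x i \<noteq> 0" by simp
          then have "\<mu> (E \<inter> shift (\<lambda>i. y i - x i) -` E) \<le> b * \<mu> E" by (rule overlap)
          moreover have "0 \<le> \<mu> E * \<mu> E" by simp
          ultimately have "\<mu> (E \<inter> shift (\<lambda>i. y i - x i) -` E) \<le> \<mu> E * \<mu> E + b * \<mu> E"
            by linarith
          then show ?thesis
            using False near y unfolding measure_hit_Int_hit_eq by (simp add: Y_def p_def)
        qed
      qed
    qed
    also have "\<dots> = real (card X) * p * p + real (card Y) * b * p"
      using finX by (simp add: sum.distrib sum.If_cases Y_def Int_def)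
    also have "real (card X) * p \<le> real L ^ CARD('d) * p"
      unfolding cX p_def using \<open>K \<le> L\<close> by (intro mult_right_mono) (auto intro: power_mono)
    also have "\<dots> \<le> 1/2" using L(2) by (simp add: p_def)
    \<comment> \<open>For \<open>r \<le> n\<close> the near positions are at most
      \<open>(2 * n + 1) ^ CARD('d)\<close> in number and \<open>b\<close> absorbs them. For
      \<open>r > n\<close> the spacing already makes distinct positions apart, so small
      \<open>n\<close> needs no smallness of \<open>b\<close>.\<close>
    also have "real (card Y) * b \<le> 1/2"
    proof (cases "r \<le> n")
      case True
      have "Y \<subseteq> {y. \<forall>i. y i \<in> {x i - int n..x i + int n}}"
        by (auto simp: Y_def apart_def not_less abs_le_iff algebra_simps)
      moreover have "finite {y. \<forall>i::'d. y i \<in> {x i - int n..x i + int n}}"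
        "card {y. \<forall>i::'d. y i \<in> {x i - int n..x i + int n}} = (2 * n + 1) ^ CARD('d)"
        by (rule card_functions_into; simp)+
      ultimately have "card Y \<le> (2 * n + 1) ^ CARD('d)"
        using card_mono[of "{y. \<forall>i::'d. y i \<in> {x i - int n..x i + int n}}" Y] by simp
      then have "real (card Y) \<le> real ((2 * n + 1) ^ CARD('d))" by (rule of_nat_mono)
      then have "real (card Y) * b \<le> (2 * real n + 1) ^ CARD('d) * b"
        using b(2) by (intro mult_right_mono) (simp_all add: add.commute)
      then show ?thesis using b(1)[OF True] by simp
    next
      case False
      have "Y = {}"
      proof (rule ccontr)
        assume "Y \<noteq> {}"
        then obtain y where y: "y \<in> X" "y \<noteq> x" "\<not> apart n x y" by (auto simp: Y_def)
        then obtain j k where jk: "x = f j" "y = f k" using x_in by (auto simp: X_def)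
        then have "j \<noteq> k" using y(2) by auto
        then obtain i where "j i \<noteq> k i" by (auto simp: fun_eq_iff)
        then have "1 \<le> \<bar>j i - k i\<bar>" by simp
        then have "int r * 1 \<le> int r * \<bar>j i - k i\<bar>" by (intro mult_left_mono) auto
        also have "\<dots> = \<bar>x i - y i\<bar>" using jk by (simp add: f_def abs_mult flip: right_diff_distrib)
        also have "\<dots> \<le> int n" using y(3) by (auto simp: apart_def not_less)
        finally show False using False by simp
      qed
      then show ?thesis by simp
    qed
    finally show ?thesis by (simp add: p_def mult_right_mono)
  qed
  have "(real L / real r) ^ CARD('d) \<le> real K ^ CARD('d)"
  proof (rule power_mono)
    have "real L \<le> real r * real K" using rK(2) unfolding of_nat_mult[symmetric] by (rule of_nat_mono)
    then show "real L / real r \<le> real K" using r by (simp add: field_simps)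
  qed simp
  then have "(real L / real r) ^ CARD('d) * \<mu> E / 2 \<le> card X * p / 2"
    by (simp add: cX p_def mult_right_mono)
  also have "\<dots> \<le> (\<Sum>x\<in>X. \<mu> (shift x -` E))
      - (\<Sum>x\<in>X. \<Sum>y\<in>X. if x = y then 0 else \<mu> (shift x -` E \<inter> shift y -` E)) / 2"
    using sum_bounded_above[of X, OF near] by (simp add: measure_hit p_def)
  also have "\<dots> \<le> \<mu> (\<Union>x\<in>X. shift x -` E)"
    by (rule bernoulli.bonferroni_lower[OF finX sets_hit])
  also have "(\<Union>x\<in>X. shift x -` E) = - nohit X" by (auto simp: nohit_def)
  also have "\<mu> \<dots> = 1 - \<mu> (nohit X)"
    using bernoulli.prob_compl[OF sets_nohit[OF finX]] by (simp add: Compl_eq_Diff_UNIV)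
  also have "\<mu> (nohit X) \<ge> \<mu> (nohit (grid L))"
    using \<open>X \<subseteq> grid L\<close> by (intro bernoulli.finite_measure_mono nohit_antimono sets_nohit finX)
  then have "1 - \<mu> (nohit X) \<le> 1 - \<mu> (nohit (grid L))" by simp
  finally show ?thesis .
qed

end

section \<open>The exponential approximation\<close>

lemma one_minus_exp_le: "1 - exp (- x) \<le> (x::real)"
  using exp_ge_add_one_self[of "- x"] by linarith

text \<open>Here \<open>x\<close> is the probability of no occurrence among the positions of a box of side \<open>M\<close>, and
  \<open>s\<close> the time, so that \<open>v\<close> is the side of the first cube of cardinality exceeding \<open>s\<close>.\<close>

lemma exponential_approximation:
  fixes p H C1 \<Lambda> \<Lambda>1 s x B :: real and n v L d :: nat
  defines "M \<equiv> v - 1 - n" and "m \<equiv> (v - 1 - n) div (L + n)" and "t \<equiv> \<Lambda> * p * s"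
  defines "c0 \<equiv> (1 / (2 * (1 + C1))) ^ d" and "D \<equiv> real d * (1/2 + C1)" and "F \<equiv> (2 * (1 + 2 * C1)) ^ d"
  assumes d: "d \<ge> 1" and L: "L \<ge> 1" "real L \<le> H\<^sup>2" and H: "H \<ge> 1" "real n * H \<le> C1 * real L" and C1: "C1 > 0"
    and p: "p > 0" "p * H ^ (8 * d) \<le> 1"
    and \<Lambda>: "0 < \<Lambda>1" "\<Lambda>1 \<le> \<Lambda>" "\<Lambda> \<le> 2"
    and v: "v \<ge> 1" "(real v - 1) ^ d \<le> s" "s < real v ^ d"
    and B: "B \<ge> 0"
    and x: "x \<le> 1" "1 - x \<le> p * real M ^ d"
      "x \<le> exp (- (\<Lambda> * p * (real m * real L) ^ d))"
      "exp (- (\<Lambda> * p * (real m * real L) ^ d)) * (1 - (real M ^ d - (real m * real L) ^ d) * p * B) \<le> x"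
  shows "\<bar>x - exp (- t)\<bar> \<le>
    (2 / c0 * (D / \<Lambda>1 * (B + 2)) + 2 * F * exp (c0 * F)) * exp (- (c0 / 2) * t) / H"
proof -
  have c0: "c0 > 0" "c0 \<le> 1" using C1 by (auto simp: c0_def intro!: power_le_one)
  have D: "D \<ge> 0" and F: "F \<ge> 0" using C1 by (auto simp: D_def F_def)
  have Mv: "real M ^ d \<le> (real v - 1) ^ d" using v(1) by (intro power_mono) (auto simp: M_def)
  have Mv': "real M ^ d \<le> real v ^ d" by (intro power_mono) (auto simp: M_def)
  have mL_le: "(real m * real L) ^ d \<le> real M ^ d"
  proof (rule power_mono)
    have "m * L \<le> m * (L + n)" by simp
    also have "\<dots> \<le> M" by (simp add: m_def M_def)
    finally show "real m * real L \<le> real M" unfolding of_nat_mult[symmetric] by (rule of_nat_mono)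
  qed simp
  have s_ge: "(real m * real L) ^ d \<le> s" using mL_le Mv v(2) by linarith
  have s0: "s \<ge> 0" using s_ge by (rule order_trans[rotated]) simp
  have \<Lambda>p: "\<Lambda> * p > 0" "\<Lambda> > 0" using \<Lambda> p by auto
  define y where "y = \<Lambda> * p * real v ^ d"
  have ty: "0 \<le> t" "t \<le> y" using \<Lambda>p p v(3) s0 by (auto simp: t_def y_def intro!: mult_left_mono)
  \<comment> \<open>Bounds the side lost to the margin \<open>n + 1\<close> and to rounding down to
    whole blocks: \<open>v - w \<le> m * (L + n)\<close>.\<close>
  define w where "w = real L + 2 * real n"
  define U where "U = (real m * real L) ^ d"
  have E: "exp (- t) \<le> exp (- (\<Lambda> * p * U))" 
    using mult_left_mono[OF s_ge, of "\<Lambda> * p"] \<Lambda>p by (simp add: t_def U_def)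
  have n_le: "real n \<le> C1 * real L / H" using H by (simp add: pos_le_divide_eq)
  have "C1 * real L / H \<le> C1 * real L" 
    using divide_left_mono[of 1 H "C1 * real L"] H(1) C1 by simp
  then have n_le': "real n \<le> C1 * real L" using n_le by simp
  have w_le: "w \<le> (1 + 2 * C1) * real L" using n_le' by (simp add: w_def algebra_simps)
  have w0: "w > 0" using L by (simp add: w_def)
  \<comment> \<open>For short times both \<open>x\<close> and \<open>exp (- t)\<close> are within
    \<open>2 * F / H\<close> of 1. Otherwise \<open>v\<close> is so large that \<open>w\<close> is a
    fraction of at most \<open>1 / (2 * H)\<close> of it.\<close>
  show ?thesis
  proof (cases "real v < 2 * w * H")
    case True
    have "real v \<le> 2 * ((1 + 2 * C1) * H\<^sup>2) * H"
    proof -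
      have "w \<le> (1 + 2 * C1) * H\<^sup>2"
        using w_le mult_left_mono[OF L(2), of "1 + 2 * C1"] C1 by linarith
      then have "2 * w * H \<le> 2 * ((1 + 2 * C1) * H\<^sup>2) * H" using H by (intro mult_right_mono) auto
      then show ?thesis using True by simp
    qed
    also have "\<dots> = (2 * (1 + 2 * C1)) * H ^ 3" by (simp add: power2_eq_square power3_eq_cube)
    finally have "real v ^ d \<le> ((2 * (1 + 2 * C1)) * H ^ 3) ^ d" by (intro power_mono) auto
    then have "p * real v ^ d \<le> p * (F * H ^ (3 * d))"
      using p by (intro mult_left_mono) (auto simp: F_def power_mult_distrib power_mult)
    also have "\<dots> = F * (p * H ^ (3 * d))" by simp
    also have "p * H ^ (3 * d) \<le> 1 / H"
    proof -
      have "p * H ^ (3 * d) * H = p * H ^ (3 * d + 1)" by simp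
      also have "\<dots> \<le> p * H ^ (8 * d)" using H d p by (intro mult_left_mono power_increasing) auto
      also have "\<dots> \<le> 1" by (rule p)
      finally show ?thesis using H by (simp add: field_simps)
    qed
    finally have pv: "p * real v ^ d \<le> F / H" using F by (simp add: mult_left_mono)
    have "y = \<Lambda> * (p * real v ^ d)" by (simp add: y_def)
    also have "\<dots> \<le> 2 * (F / H)" using pv \<Lambda> p F by (intro mult_mono) auto
    finally have y: "y \<le> 2 * F / H" by simp
    have FH: "F / H \<le> F" using divide_left_mono[of 1 H F] F H by simp
    have "1 - x \<le> 2 * F / H" 
    proof -
      have "p * real M ^ d \<le> p * real v ^ d" using Mv' p by (intro mult_left_mono) auto
      moreover have "F / H \<ge> 0" using F H by simp
      ultimately show ?thesis using x(2) pv by simp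
    qed
    moreover have "1 - exp (- t) \<le> 2 * F / H" using one_minus_exp_le[of t] ty y by linarith
    moreover have "exp (- t) \<le> 1" using ty by simp
    ultimately have "\<bar>x - exp (- t)\<bar> \<le> 2 * F / H" using x(1) by linarith
    \<comment> \<open>Here \<open>t \<le> 2 * F\<close>, so the decaying factor can be inserted at
      the cost of \<open>exp (c0 * F)\<close>.\<close>
    also have "\<dots> \<le> 2 * F / H * (exp (c0 * F) * exp (- (c0 / 2) * t))"
    proof -
      have "c0 / 2 * t \<le> c0 / 2 * (2 * F)" using ty y FH c0 by (intro mult_left_mono) auto
      then have "1 \<le> exp (c0 * F) * exp (- (c0 / 2) * t)" by (simp flip: exp_add)
      moreover have "2 * F / H \<ge> 0" using F H by simp
      ultimately show ?thesis using mult_left_mono by fastforce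
    qed
    also have "\<dots> = (2 * F * exp (c0 * F)) * exp (- (c0 / 2) * t) / H" by simp
    also have "\<dots> \<le> (2 / c0 * (D / \<Lambda>1 * (B + 2)) + 2 * F * exp (c0 * F)) * exp (- (c0 / 2) * t) / H"
      using c0 D \<Lambda> B H by (intro divide_right_mono mult_right_mono) auto
    finally show ?thesis .
  next
    case False
    \<comment> \<open>Relative losses of side: \<open>e1\<close> from the margin and rounding,
      \<open>e2\<close> from the corridors.\<close>
    define e1 where "e1 = w / real v"
    define e2 where "e2 = real n / real (L + n)"
    have v0: "real v > 0" using v(1) by simp
    have e1: "0 \<le> e1" "e1 \<le> 1 / (2 * H)"
      using False w0 v0 H by (auto simp: e1_def field_simps)
    have "1 / (2 * H) \<le> 1/2" using H(1) by (intro divide_left_mono) auto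
    then have e1': "e1 \<le> 1/2" using e1(2) by linarith
    have e2: "0 \<le> e2" "e2 \<le> C1 / H" "1 - e2 = real L / real (L + n)"
    proof -
      show "0 \<le> e2" by (simp add: e2_def)
      have "e2 \<le> real n / real L" unfolding e2_def using L by (intro divide_left_mono) auto
      also have "\<dots> \<le> C1 / H" using H L by (simp add: field_simps)
      finally show "e2 \<le> C1 / H" .
      show "1 - e2 = real L / real (L + n)" using L by (simp add: e2_def field_simps)
    qed
    have e2': "1 - e2 \<ge> 1 / (1 + C1)"
      unfolding e2(3) using n_le' C1 L by (simp add: field_simps)
    have e2_le1: "1 - e2 \<ge> 0" unfolding e2(3) by simp
    have mL_ge: "real v * ((1 - e1) * (1 - e2)) \<le> real m * real L"
    proof -
      have "v - 1 - n = m * (L + n) + (v - 1 - n) mod (L + n)"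
        unfolding m_def by (rule div_mult_mod_eq[symmetric])
      moreover have "(v - 1 - n) mod (L + n) < L + n" using L by simp
      ultimately have "v \<le> m * (L + n) + (L + 2 * n)" by linarith
      then have "real v \<le> real (m * (L + n) + (L + 2 * n))" by (rule of_nat_mono)
      then have "real v - w \<le> real m * real (L + n)" by (simp add: w_def algebra_simps)
      moreover have "real v * (1 - e1) = real v - w" using v0 by (simp add: e1_def field_simps)
      ultimately have "real v * (1 - e1) * (1 - e2) \<le> real m * real (L + n) * (1 - e2)"
        using e2_le1 by (intro mult_right_mono) auto
      also have "\<dots> = real m * real L" using L by (simp add: e2(3))
      finally show ?thesis by (simp add: mult.assoc)
    qed
    have prod_ge: "(1 - e1) * (1 - e2) \<ge> 1 / (2 * (1 + C1))"
    proof -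
      have "1/2 * (1 / (1 + C1)) \<le> (1 - e1) * (1 - e2)"
        using e1' e2' C1 by (intro mult_mono) auto
      then show ?thesis by simp
    qed
    have prod_ge0: "(1 - e1) * (1 - e2) \<ge> 0"
      using C1 by (intro order_trans[OF _ prod_ge]) simp
    have U_ge1: "c0 * real v ^ d \<le> U"
    proof -
      have "real v * (1 / (2 * (1 + C1))) \<le> real m * real L"
        using mL_ge mult_left_mono[OF prod_ge, of "real v"] by simp
      then have "(real v * (1 / (2 * (1 + C1)))) ^ d \<le> U"
        unfolding U_def using C1 by (intro power_mono) auto
      then show ?thesis unfolding power_mult_distrib c0_def by (simp only: mult.commute)
    qed
    have U_ge2: "real v ^ d - U \<le> D / H * real v ^ d"
    proof -
      \<comment> \<open>Bernoulli's inequality turns the relative loss \<open>a\<close> of side into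
        a loss of at most \<open>d * a\<close> of volume; \<open>D / H\<close> is \<open>d\<close>
        times \<open>1 / (2 * H) + C1 / H\<close>.\<close>
      define a where "a = 1 - (1 - e1) * (1 - e2)"
      have a_le: "a \<le> e1 + e2" using e1 e2 by (simp add: a_def algebra_simps)
      have a1: "a \<le> 1" using prod_ge0 by (simp add: a_def)
      have "1 + real d * (- a) \<le> (1 + (- a)) ^ d" using a1 by (intro Bernoulli_inequality) simp
      moreover have "real d * a \<le> D / H"
      proof -
        have "real d * a \<le> real d * (1 / (2 * H) + C1 / H)"
          using a_le e1 e2 by (intro mult_left_mono) auto
        also have "\<dots> = D / H" using H by (simp add: D_def field_simps)
        finally show ?thesis .
      qed
      ultimately have "1 - D / H \<le> (1 - a) ^ d" by simp
      then have "real v ^ d * (1 - D / H) \<le> real v ^ d * (1 - a) ^ d" by (intro mult_left_mono) auto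
      also have "\<dots> = (real v * ((1 - e1) * (1 - e2))) ^ d" by (simp add: a_def power_mult_distrib)
      also have "\<dots> \<le> U" unfolding U_def
        by (rule power_mono[OF mL_ge mult_nonneg_nonneg[OF _ prod_ge0]]) simp
      finally show ?thesis by (simp add: algebra_simps)
    qed
    \<comment> \<open>\<open>G\<close> stands for the no-occurrence probability of the blocks alone.
      Both comparisons below are relative to \<open>G\<close>, so the error keeps its exponential
      decay in time.\<close>
    define G where "G = exp (- (\<Lambda> * p * U))"
    have G_le: "G \<le> exp (- (c0 * y))"
    proof -
      have "\<Lambda> * p * (c0 * real v ^ d) \<le> \<Lambda> * p * U" using U_ge1 \<Lambda>p by (intro mult_left_mono) auto
      then show ?thesis by (simp add: G_def y_def mult_ac)
    qed
    have y0: "y \<ge> 0" using ty by linarith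
    have pv: "p * real v ^ d \<le> y / \<Lambda>1"
    proof -
      have "\<Lambda>1 * (p * real v ^ d) \<le> \<Lambda> * (p * real v ^ d)" using \<Lambda> p by (intro mult_right_mono) auto
      then show ?thesis using \<Lambda> by (simp add: y_def field_simps)
    qed
    define \<delta> where "\<delta> = D / H"
    have \<delta>: "\<delta> \<ge> 0" using D H by (simp add: \<delta>_def)
    have diff1: "exp (- t) - x \<le> G * (\<delta> * (p * real v ^ d) * (B + 2))"
    proof -
      have "G - x \<le> G * ((real M ^ d - U) * p * B)" using x(4) by (simp add: G_def U_def algebra_simps)
      also have "\<dots> \<le> G * (\<delta> * real v ^ d * p * B)"
        using U_ge2 Mv' p B by (intro mult_left_mono mult_right_mono) (auto simp: G_def \<delta>_def)
      also have "\<dots> \<le> G * (\<delta> * (p * real v ^ d) * (B + 2))"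
        using \<delta> p by (intro mult_left_mono) (auto simp: G_def algebra_simps)
      finally show ?thesis using E unfolding G_def by linarith
    qed
    have diff2: "x - exp (- t) \<le> G * (\<delta> * (p * real v ^ d) * (B + 2))"
    proof -
      have "x - exp (- t) \<le> G - exp (- t)" using x(3) by (simp add: G_def U_def)
      also have "\<dots> = G * (1 - exp (- (t - \<Lambda> * p * U)))" 
        by (simp add: G_def right_diff_distrib flip: exp_add)
      also have "\<dots> \<le> G * (t - \<Lambda> * p * U)"
        by (intro mult_left_mono one_minus_exp_le) (simp add: G_def)
      also have "\<dots> \<le> G * (\<Lambda> * p * (\<delta> * real v ^ d))"
      proof -
        have "\<Lambda> * p * (real v ^ d - U) \<le> \<Lambda> * p * (\<delta> * real v ^ d)"
          using U_ge2 \<Lambda>p by (intro mult_left_mono) (auto simp: \<delta>_def)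
        then have "t - \<Lambda> * p * U \<le> \<Lambda> * p * (\<delta> * real v ^ d)"
          using ty(2) by (simp add: y_def right_diff_distrib)
        then show ?thesis by (intro mult_left_mono) (simp_all add: G_def)
      qed
      also have "\<dots> = G * (\<delta> * (p * real v ^ d) * \<Lambda>)" by simp
      also have "\<dots> \<le> G * (\<delta> * (p * real v ^ d) * (B + 2))"
        using \<delta> p B \<Lambda> by (intro mult_left_mono) (auto simp: G_def)
      finally show ?thesis .
    qed
    have "\<bar>x - exp (- t)\<bar> \<le> G * (\<delta> * (p * real v ^ d) * (B + 2))"
      using diff1 diff2 by linarith
    also have "\<dots> \<le> exp (- (c0 * y)) * (\<delta> * (y / \<Lambda>1) * (B + 2))"
      using G_le pv \<delta> B y0 \<Lambda> p by (intro mult_mono mult_nonneg_nonneg) auto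
    also have "\<dots> = (D / \<Lambda>1 * (B + 2)) / H * (y * exp (- (c0 * y)))" by (simp add: \<delta>_def mult_ac)
    \<comment> \<open>Half of the decay rate is spent on absorbing the linear factor
      \<open>y\<close>.\<close>
    also have "\<dots> \<le> (D / \<Lambda>1 * (B + 2)) / H * (2 / c0 * exp (- (c0 / 2) * t))"
    proof (intro mult_left_mono)
      have "c0 / 2 * y \<le> exp (c0 / 2 * y)" using exp_ge_add_one_self[of "c0 / 2 * y"] by linarith
      then have "y \<le> 2 / c0 * exp (c0 / 2 * y)" using c0 by (simp add: field_simps)
      then have "y * exp (- (c0 * y)) \<le> 2 / c0 * exp (c0 / 2 * y) * exp (- (c0 * y))"
        by (intro mult_right_mono) auto
      also have "\<dots> = 2 / c0 * exp (- (c0 / 2 * y))"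
        by (simp add: mult.assoc flip: exp_add)
      also have "\<dots> \<le> 2 / c0 * exp (- (c0 / 2) * t)"
        using c0 ty by (intro mult_left_mono) auto
      finally show "y * exp (- (c0 * y)) \<le> 2 / c0 * exp (- (c0 / 2) * t)" .
    qed (use D \<Lambda> B H in auto)
    also have "\<dots> = (2 / c0 * (D / \<Lambda>1 * (B + 2))) * exp (- (c0 / 2) * t) / H" by (simp add: mult_ac)
    also have "\<dots> \<le> (2 / c0 * (D / \<Lambda>1 * (B + 2)) + 2 * F * exp (c0 * F)) * exp (- (c0 / 2) * t) / H"
      using F H by (intro divide_right_mono mult_right_mono) auto
    finally show ?thesis .
  qed
qed

section \<open>Hitting times\<close>

text \<open>\<open>cube k\<close> has \<open>k + 1\<close> sites per side, so a time at most
  \<open>s\<close> means an occurrence inside \<open>cube (v - 2)\<close>, whose admissible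
  positions form \<open>grid (v - 1 - n)\<close>. For \<open>v \<le> n + 1\<close> nothing fits and
  truncated subtraction gives the empty grid. When something fits, \<open>n \<ge> 1\<close> secures
  \<open>v - 2 > 0\<close>, as the definition of the hitting time demands.\<close>

lemma hit_time_gt_iff:
  fixes A \<sigma> :: "'d::finite config"
  assumes n: "n \<ge> 1" and v: "v \<ge> 1" "(real v - 1) ^ CARD('d) \<le> s" "s < real v ^ CARD('d)"
  shows "hit_time n \<epsilon> A \<sigma> > ereal s \<longleftrightarrow> (\<forall>x\<in>grid (v - 1 - n). shift x \<sigma> \<notin> approx_set n \<epsilon> A)"
proof
  assume L: "hit_time n \<epsilon> A \<sigma> > ereal s"
  show "\<forall>x\<in>grid (v - 1 - n). shift x \<sigma> \<notin> approx_set n \<epsilon> A"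
  proof (rule ccontr)
    assume "\<not> ?thesis"
    then obtain x where x: "x \<in> grid (v - 1 - n)" "shift x \<sigma> \<in> approx_set n \<epsilon> A" by blast
    have xi: "0 \<le> x i" "x i < int (v - 1 - n)" for i using x(1) by (auto simp: grid_def)
    have nv: "n + 2 \<le> v" using xi[of undefined] by linarith
    have "vadd x ` cube n \<subseteq> cube (v - 2)"
    proof
      fix y assume "y \<in> vadd x ` cube n"
      then obtain a where a: "a \<in> cube n" "y = vadd x a" by blast
      have "0 \<le> y i \<and> y i \<le> int (v - 2)" for i
      proof -
        have "0 \<le> a i" "a i \<le> int n" using a(1) by (auto simp: cube_def)
        then show ?thesis using xi[of i] nv by (simp add: a(2) vadd_def)
      qed
      then show "y \<in> cube (v - 2)" by (simp add: cube_def)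
    qed
    moreover have "v - 2 > 0" using nv n by simp
    ultimately have "hit_time n \<epsilon> A \<sigma> \<le> ereal (real (card (cube (v - 2) :: 'd site set)))"
      unfolding hit_time_def using x(2) by (intro Inf_lower) blast
    also have "real (card (cube (v - 2) :: 'd site set)) = (real v - 1) ^ CARD('d)"
    proof -
      have "real (v - 2 + 1) = real v - 1" using nv by simp
      then show ?thesis by (simp only: card_cube of_nat_power)
    qed
    finally have "hit_time n \<epsilon> A \<sigma> \<le> ereal s" using v(2) by (meson ereal_less_eq(3) order_trans)
    with L show False by simp
  qed
next
  assume R: "\<forall>x\<in>grid (v - 1 - n). shift x \<sigma> \<notin> approx_set n \<epsilon> A"
  have "ereal (real v ^ CARD('d)) \<le> hit_time n \<epsilon> A \<sigma>"
    unfolding hit_time_def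
  proof (rule Inf_greatest)
    fix z assume "z \<in> {ereal (real (card (cube k :: 'd site set))) | k. k > 0 \<and>
      (\<exists>x. vadd x ` cube n \<subseteq> cube k \<and> shift x \<sigma> \<in> approx_set n \<epsilon> A)}"
    then obtain k x where z: "z = ereal (real (card (cube k :: 'd site set)))"
      and x: "vadd x ` cube n \<subseteq> cube k" "shift x \<sigma> \<in> approx_set n \<epsilon> A" by blast
    have "v \<le> k + 1"
    proof (rule ccontr)
      assume "\<not> v \<le> k + 1"
      have "(\<lambda>_. 0) \<in> cube n" "(\<lambda>_. int n) \<in> cube n" by (simp_all add: cube_def)
      then have "vadd x (\<lambda>_. 0) \<in> cube k" "vadd x (\<lambda>_. int n) \<in> cube k" using x(1) by blast+
      then have xi: "0 \<le> x i" "x i + int n \<le> int k" for i by (simp_all add: cube_def vadd_def)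
      have "0 \<le> x i \<and> x i < int (v - 1 - n)" for i
        using xi[of i] \<open>\<not> v \<le> k + 1\<close> by linarith
      then have "x \<in> grid (v - 1 - n)" by (simp add: grid_def)
      with R x(2) show False by blast
    qed
    then have "real v ^ CARD('d) \<le> real (k + 1) ^ CARD('d)" by (intro power_mono) simp_all
    then show "ereal (real v ^ CARD('d)) \<le> z" unfolding z card_cube of_nat_power by simp
  qed
  then show "hit_time n \<epsilon> A \<sigma> > ereal s" using v(3) by (meson ereal_less(1) less_le_trans less_ereal.simps(1))
qed

section \<open>Thresholds and size estimates\<close>

lemma approx_set_eq:
  fixes A :: "'d::finite config"
  assumes "\<epsilon> \<ge> 0"
  shows "approx_set n \<epsilon> A = {\<sigma>. mismatches (cube n) \<sigma> A \<le> nat \<lfloor>\<epsilon> * real (card (cube n :: 'd site set))\<rfloor>}"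
proof -
  have "real k \<le> a \<longleftrightarrow> k \<le> nat \<lfloor>a\<rfloor>" if "a \<ge> 0" for a :: real and k :: nat
    using that by (simp only: le_nat_iff zero_le_floor le_floor_iff of_int_of_nat_eq)
  then show ?thesis
    using assms by (simp add: approx_set_def Delta_eq_mismatches finite_cube del: of_nat_le_iff)
qed

lemma power_between:
  fixes s :: real assumes "s > 0" "d \<ge> 1"
  obtains v :: nat where "v \<ge> 1" "(real v - 1) ^ d \<le> s" "s < real v ^ d"
proof -
  obtain u :: nat where u: "max 1 s < real u" using reals_Archimedean2 by blast
  then have "real u ^ 1 \<le> real u ^ d" using assms(2) by (intro power_increasing) auto
  then have ex: "s < real u ^ d" using u unfolding power_one_right by linarith
  define v where "v = (LEAST v. s < real v ^ d)"
  have v: "s < real v ^ d" unfolding v_def by (rule LeastI[of "\<lambda>v. s < real v ^ d", OF ex])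
  have "v \<noteq> 0" using v assms by (intro notI) (simp add: zero_power)
  then have v1: "v \<ge> 1" by simp
  have "\<not> s < real (v - 1) ^ d" using v1 unfolding v_def by (intro not_less_Least) (simp flip: v_def)
  then show thesis using v1 v by (intro that[of v]) (simp_all add: of_nat_diff)
qed

text \<open>Provides the sublattice spacing for the Bonferroni bound. It depends only on the
  dimension, which makes the lower bound on \<open>\<Lambda>\<close> uniform in the pattern and in
  \<open>n\<close>.\<close>

lemma polynomial_times_geometric_small:
  "\<exists>r\<ge>1. \<forall>n\<ge>r. (2 * real n + 1) ^ d * (2 * (9/10) ^ (n + 1)) \<le> (1/2 :: real)"
proof -
  have "(\<lambda>n. (2 * real n + 1) ^ d * (2 * (9/10) ^ (n + 1))) \<longlonglongrightarrow> (0::real)"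
    by real_asymp
  then have "eventually (\<lambda>n. (2 * real n + 1) ^ d * (2 * (9/10) ^ (n + 1)) < (1/2::real)) sequentially"
    by (rule order_tendstoD) simp
  then obtain r where "\<forall>n\<ge>r. (2 * real n + 1) ^ d * (2 * (9/10) ^ (n + 1)) < (1/2::real)"
    by (auto simp: eventually_sequentially)
  then show ?thesis by (intro exI[of _ "max r 1"]) (auto intro: less_imp_le)
qed

text \<open>Here \<open>H ^ (8 * CARD('d))\<close> is \<open>2 powr (N / 3)\<close>. Raising the
  Chernoff bound to the power 24 clears the fractions and reduces the second claim to
  \<open>2 * (3/4) ^ 24 * 2 ^ 8 \<le> 1\<close>. The third uses the spare factor
  \<open>H ^ (6 * CARD('d)) \<ge> 2\<close>.\<close>

lemma approx_set_estimates:
  fixes A :: "'d::finite config" and r n :: nat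
  defines "N \<equiv> card (cube n :: 'd site set)" and "p \<equiv> measure bernoulli_field {\<sigma>. mismatches (cube n) \<sigma> A \<le> r}"
  defines "H \<equiv> 2 powr (real N / (24 * real CARD('d)))"
  assumes r: "24 * r \<le> N" and N: "N \<ge> 4"
  shows "0 < p" "p * H ^ (8 * CARD('d)) \<le> 1" "p * (H\<^sup>2) ^ CARD('d) \<le> 1/2"
proof -
  show p0: "0 < p"
    unfolding p_def measure_mismatches_le[OF finite_cube]
    by (intro divide_pos_pos) (auto simp: ball_volume_def sum.atMost_shift intro!: add_pos_nonneg sum_nonneg)
  have H8: "H ^ (8 * CARD('d)) = 2 powr (real N / 3)"
    by (simp add: H_def powr_power)
  have "p * 2 powr (real N / 3) \<le> 1"
  proof (rule power_le_imp_le_base)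
    have "p \<le> 2 ^ r * (3/4) ^ N"
      unfolding p_def N_def by (rule measure_mismatches_chernoff[OF finite_cube])
    then have "p ^ 24 \<le> (2 ^ r * (3/4) ^ N) ^ 24" using p0 by (intro power_mono) auto
    also have "\<dots> = 2 ^ (24 * r) * ((3/4) ^ 24) ^ N"
      by (simp only: power_mult_distrib power_mult[symmetric] mult.commute)
    also have "\<dots> \<le> 2 ^ N * ((3/4) ^ 24) ^ N"
      using r by (intro mult_right_mono power_increasing) auto
    finally have p24: "p ^ 24 \<le> 2 ^ N * ((3/4) ^ 24) ^ N" .
    have q24: "(2 powr (real N / 3)) ^ 24 = ((2::real) ^ 8) ^ N"
    proof -
      have "((2::real) powr (real N / 3)) ^ 24 = 2 powr real (8 * N)" by (simp add: powr_power)
      also have "\<dots> = 2 ^ (8 * N)" by (rule powr_realpow) simp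
      also have "\<dots> = (2 ^ 8) ^ N" by (rule power_mult)
      finally show ?thesis .
    qed
    have "(p * 2 powr (real N / 3)) ^ Suc 23 = p ^ 24 * ((2::real) ^ 8) ^ N"
      by (simp only: power_mult_distrib q24[symmetric]) simp
    also have "\<dots> \<le> 2 ^ N * ((3/4) ^ 24) ^ N * (2 ^ 8) ^ N"
      using p24 by (intro mult_right_mono) auto
    also have "\<dots> = (2 * (3/4) ^ 24 * 2 ^ 8) ^ N" by (simp only: power_mult_distrib)
    also have "\<dots> \<le> 1" by (intro power_le_one) (simp_all add: power_divide)
    finally show "(p * 2 powr (real N / 3)) ^ Suc 23 \<le> 1 ^ Suc 23" by simp
  qed simp
  then show ph: "p * H ^ (8 * CARD('d)) \<le> 1" by (simp add: H8)
  have H1: "H > 0" by (simp add: H_def)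
  have H6: "2 \<le> H ^ (6 * CARD('d))"
  proof -
    have "H ^ (6 * CARD('d)) = 2 powr (real N / 4)" by (simp add: H_def powr_power)
    moreover have "2 powr 1 \<le> (2::real) powr (real N / 4)" using N by (intro powr_mono) auto
    ultimately show ?thesis by simp
  qed
  have "p * (H\<^sup>2) ^ CARD('d) * 2 \<le> p * (H\<^sup>2) ^ CARD('d) * H ^ (6 * CARD('d))"
    using H6 p0 H1 by (intro mult_left_mono) auto
  also have "\<dots> = p * H ^ (8 * CARD('d))"
    by (simp add: power_add[symmetric] power_mult[symmetric] mult.assoc)
  also have "\<dots> \<le> 1" by (rule ph)
  finally show "p * (H\<^sup>2) ^ CARD('d) \<le> 1/2" by simp
qed

text \<open>Follows from \<open>x \<le> exp x\<close> and \<open>ln 2 \<ge> 1/2\<close>; it bounds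
  \<open>n\<close> by a constant multiple of \<open>H\<close>.\<close>

lemma linear_le_powr:
  fixes a :: real assumes "a > 0" "N \<ge> 0"
  shows "N \<le> 2 * a * 2 powr (N / a)"
proof -
  have "1/2 \<le> ln (2::real)" using ln2_ge_two_thirds by simp
  then have "N / a * (1/2) \<le> N / a * ln 2" using assms by (intro mult_left_mono) auto
  also have "\<dots> \<le> exp (N / a * ln 2)" using exp_ge_add_one_self[of "N / a * ln 2"] by linarith
  also have "\<dots> = 2 powr (N / a)" by (simp add: powr_def)
  finally show ?thesis using assms by (simp add: field_simps)
qed

section \<open>The law for a fixed pattern\<close>

text \<open>The block side \<open>L\<close> is the integer part of \<open>H ^ 2\<close>: small
  enough for \<open>L ^ d * p \<le> 1/2\<close>, large enough for \<open>n / L\<close> to be of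
  order \<open>1 / H\<close>. All constants depend only on the dimension and
  \<open>r0\<close>.\<close>

lemma pattern_exponential_law:
  fixes A :: "'d::finite config" and \<epsilon> :: real and n r0 :: nat
  defines "d \<equiv> CARD('d)"
  defines "C1 \<equiv> 96 * real d" and "B \<equiv> (2::real) ^ 2 ^ d" and "\<Lambda>1 \<equiv> (1 / real r0) ^ d / 2"
  defines "c0 \<equiv> (1 / (2 * (1 + C1))) ^ d" and "D \<equiv> real d * (1/2 + C1)" and "F \<equiv> (2 * (1 + 2 * C1)) ^ d"
  defines "C \<equiv> 2 / c0 * (D / \<Lambda>1 * (B + 2)) + 2 * F * exp (c0 * F)"
  assumes dim: "CARD('d) \<ge> 2" and eps: "0 < \<epsilon>" "\<epsilon> < 1/1024" and n: "n \<ge> 1"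
    and r0: "r0 \<ge> 1" "\<And>n. n \<ge> r0 \<Longrightarrow> (2 * real n + 1) ^ d * (2 * (9/10) ^ (n + 1)) \<le> 1/2"
  shows "\<exists>\<Lambda>. \<Lambda>1 \<le> \<Lambda> \<and> \<Lambda> \<le> 2 \<and> (\<forall>t>0.
    \<bar>measure bernoulli_field {\<sigma> \<in> space bernoulli_field. hit_time n \<epsilon> A \<sigma> >
        ereal (t / (\<Lambda> * measure bernoulli_field (approx_set n \<epsilon> A)))} - exp (- t)\<bar>
      \<le> C * exp (- (c0 / 2) * t) * exp (- (ln 2 / (24 * real d)) * real n ^ d))"
proof -
  define N where "N = card (cube n :: 'd site set)"
  define r where "r = nat \<lfloor>\<epsilon> * real N\<rfloor>"
  define E where "E = {\<sigma>. mismatches (cube n) \<sigma> A \<le> r}"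
  define p where "p = measure bernoulli_field E"
  define H where "H = 2 powr (real N / (24 * real d))"
  define L where "L = nat \<lfloor>H\<^sup>2\<rfloor>"
  interpret local_pattern n E
    unfolding E_def by unfold_locales (rule depends_on_mismatches)
  have E_eq: "approx_set n \<epsilon> A = E"
    unfolding E_def r_def N_def using eps by (intro approx_set_eq) simp
  have d: "d \<ge> 2" "d \<ge> 1" using dim by (simp_all add: d_def)
  have N_eq: "N = (n + 1) ^ d" by (simp add: N_def card_cube d_def)
  have N4: "N \<ge> 4"
  proof -
    have "(2::nat) ^ 2 \<le> 2 ^ d" using d by (intro power_increasing) auto
    also have "\<dots> \<le> N" unfolding N_eq using n by (intro power_mono) auto
    finally show ?thesis by simp
  qed
  have r: "1024 * r \<le> N"
  proof -
    have "real r \<le> \<epsilon> * real N" unfolding r_def using eps by simp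
    also have "\<dots> \<le> 1/1024 * real N" using eps by (intro mult_right_mono) auto
    finally show ?thesis by linarith
  qed
  have est: "0 < p" "p * H ^ (8 * d) \<le> 1" "p * (H\<^sup>2) ^ d \<le> 1/2"
    using approx_set_estimates[of r n A] r N4
    by (simp_all add: p_def E_def H_def N_def d_def)
  have H: "H \<ge> 1" unfolding H_def by (intro ge_one_powr_ge_zero) auto
  have H2: "H\<^sup>2 \<ge> 1" using H by simp
  have L: "L \<ge> 1" "real L \<le> H\<^sup>2" "H\<^sup>2 \<le> 2 * real L"
  proof -
    show L1: "L \<ge> 1" using H2 by (simp add: L_def le_nat_iff)
    show "real L \<le> H\<^sup>2" using H2 by (simp add: L_def)
    have "H\<^sup>2 < real L + 1" using H2 by (simp add: L_def)
    then show "H\<^sup>2 \<le> 2 * real L" using L1 by simp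
  qed
  have C1: "C1 > 0" using d by (simp add: C1_def)
  \<comment> \<open>The 96 in \<open>C1\<close> is \<open>2 * 24 * 2\<close>: the first two factors
    come from bounding \<open>N\<close> by a multiple of \<open>H\<close>, the last from
    \<open>H ^ 2 \<le> 2 * L\<close>.\<close>
  have nH: "real n * H \<le> C1 * real L"
  proof -
    have "n + 1 \<le> N" unfolding N_eq using d by (intro self_le_power) auto
    then have "real n \<le> real N" by simp
    also have "\<dots> \<le> 2 * (24 * real d) * H" unfolding H_def using d by (intro linear_le_powr) auto
    finally have "real n * H \<le> 2 * (24 * real d) * H * H" using H by (intro mult_right_mono) auto
    also have "\<dots> = 2 * (24 * real d) * H\<^sup>2" by (simp add: power2_eq_square)
    also have "\<dots> \<le> 2 * (24 * real d) * (2 * real L)" using L(3) by (intro mult_left_mono) auto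
    finally show ?thesis by (simp add: C1_def)
  qed
  have pL: "real L ^ d * p \<le> 1/2"
  proof -
    have "p * real L ^ d \<le> p * (H\<^sup>2) ^ d" using est(1) L(2) by (intro mult_left_mono power_mono) auto
    then show ?thesis using est(3) by (simp add: mult.commute)
  qed
  define g where "g = measure bernoulli_field (nohit (grid L))"
  have g_ge: "1 - g \<le> real L ^ d * p"
    using measure_nohit_union_bound[OF finite_grid, of L] by (simp add: g_def p_def card_grid d_def)
  have g_le: "\<Lambda>1 * (p * real L ^ d) \<le> 1 - g"
  proof -
    have "(real L / real r0) ^ CARD('d) * \<mu> E / 2 \<le> 1 - \<mu> (nohit (grid L))"
    proof (rule hit_probability_ge)
      show "\<mu> (E \<inter> shift z -` E) \<le> 2 * (9/10) ^ (n + 1) * \<mu> E" if "z i \<noteq> 0" for z i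
        using overlap_bound[of z i r n A] dim that r by (simp add: E_def N_def)
      show "(2 * real n + 1) ^ CARD('d) * (2 * (9/10) ^ (n + 1)) \<le> 1/2" if "r0 \<le> n"
        using r0(2)[OF that] by (simp add: d_def)
    qed (use L(1) pL r0(1) in \<open>simp_all add: p_def d_def\<close>)
    then show ?thesis by (simp add: g_def p_def d_def \<Lambda>1_def power_divide field_simps)
  qed
  have \<Lambda>1: "\<Lambda>1 > 0" using r0(1) by (simp add: \<Lambda>1_def)
  have pLd: "p * real L ^ d > 0" using est(1) L(1) by simp
  have g: "1/2 \<le> g" "g < 1"
    using g_ge pL g_le mult_pos_pos[OF \<Lambda>1 pLd] by linarith+
  \<comment> \<open>With this choice \<open>g ^ (m ^ d)\<close> equals
    \<open>exp (- (\<Lambda> * p * (m * L) ^ d))\<close> exactly. The bounds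
    \<open>1 - g \<le> - ln g \<le> 2 * (1 - g)\<close>, valid for \<open>1/2 \<le> g < 1\<close>,
    transfer the estimates of \<open>1 - g\<close> to \<open>\<Lambda>\<close>.\<close>
  define \<Lambda> where "\<Lambda> = - ln g / (p * real L ^ d)"
  have "p * real L ^ d \<noteq> 0" using pLd by linarith
  then have ln_g: "- ln g = \<Lambda> * (p * real L ^ d)"
    unfolding \<Lambda>_def times_divide_eq_left by (rule nonzero_mult_div_cancel_right[symmetric])
  have \<Lambda>_ge: "\<Lambda>1 \<le> \<Lambda>"
  proof -
    have "\<Lambda>1 * (p * real L ^ d) \<le> \<Lambda> * (p * real L ^ d)"
      using ln_le_minus_one[of g] g g_le ln_g by linarith
    then show ?thesis using pLd by (simp add: mult_le_cancel_right)
  qed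
  have \<Lambda>_le: "\<Lambda> \<le> 2"
  proof -
    have "- ln g \<le> 1 / g - 1" using ln_le_minus_one[of "1 / g"] g by (simp add: ln_div)
    also have "\<dots> \<le> 2 * (1 - g)"
    proof -
      have "2 * (1 - g) * (1/2) \<le> 2 * (1 - g) * g" using g by (intro mult_left_mono) simp_all
      moreover have "2 * (1 - g) * (1/2) = 1 - g" by simp
      ultimately have "1 - g \<le> 2 * (1 - g) * g" by (simp only:)
      then have "(1 - g) / g \<le> 2 * (1 - g)" using g by (subst pos_divide_le_eq) auto
      then show ?thesis using g by (simp add: diff_divide_distrib)
    qed
    also have "\<dots> \<le> 2 * (p * real L ^ d)" using g_ge by (simp add: mult.commute)
    finally have "\<Lambda> * (p * real L ^ d) \<le> 2 * (p * real L ^ d)" using ln_g by simp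
    then show ?thesis using pLd by (simp add: mult_le_cancel_right)
  qed
  have \<Lambda>0: "\<Lambda> > 0" using \<Lambda>_ge \<Lambda>1 by linarith
  have "\<bar>measure bernoulli_field {\<sigma> \<in> space bernoulli_field. hit_time n \<epsilon> A \<sigma> >
        ereal (t / (\<Lambda> * measure bernoulli_field (approx_set n \<epsilon> A)))} - exp (- t)\<bar>
      \<le> C * exp (- (c0 / 2) * t) * exp (- (ln 2 / (24 * real d)) * real n ^ d)" if t: "t > 0" for t
  proof -
    define s where "s = t / (\<Lambda> * p)"
    have s: "s > 0" using t \<Lambda>0 est(1) by (simp add: s_def)
    have ts: "t = \<Lambda> * p * s" using \<Lambda>0 est(1) by (simp add: s_def)
    obtain v :: nat where v: "v \<ge> 1" "(real v - 1) ^ d \<le> s" "s < real v ^ d"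
      using power_between[OF s d(2)] .
    define M where "M = v - 1 - n"
    define m where "m = (v - 1 - n) div (L + n)"
    have mM: "m * (L + n) \<le> M" by (simp add: m_def M_def)
    define x where "x = measure bernoulli_field (nohit (grid M))"
    have x_eq: "measure bernoulli_field {\<sigma> \<in> space bernoulli_field. hit_time n \<epsilon> A \<sigma> >
        ereal (t / (\<Lambda> * measure bernoulli_field (approx_set n \<epsilon> A)))} = x"
      using hit_time_gt_iff[OF n v[unfolded d_def], of \<epsilon> A]
      by (simp add: E_eq x_def nohit_def M_def s_def p_def)
    have gm: "g ^ (m ^ d) = exp (- (\<Lambda> * p * (real m * real L) ^ d))"
    proof -
      have "g ^ (m ^ d) = exp (real (m ^ d) * ln g)" unfolding exp_of_nat_mult using g by simp
      also have "real (m ^ d) * ln g = - (\<Lambda> * p * (real m * real L) ^ d)"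
      proof -
        have "ln g = - (\<Lambda> * (p * real L ^ d))" using ln_g by linarith
        then show ?thesis by (simp add: power_mult_distrib)
      qed
      finally show ?thesis .
    qed
    have mL: "(real m * real L) ^ d \<le> real M ^ d"
    proof (rule power_mono)
      have "m * L \<le> M" using mM by (simp add: add_mult_distrib2)
      then show "real m * real L \<le> real M" unfolding of_nat_mult[symmetric] by (rule of_nat_mono)
    qed simp
    have "\<bar>x - exp (- t)\<bar> \<le> C * exp (- (c0 / 2) * t) / H"
      unfolding C_def c0_def D_def F_def ts
    proof (rule exponential_approximation[where n = n and v = v and L = L])
      show "1 - x \<le> p * real (v - 1 - n) ^ d"
        using measure_nohit_union_bound[OF finite_grid, of M]
        by (simp add: x_def p_def card_grid d_def M_def mult.commute)
      show "x \<le> exp (- (\<Lambda> * p * (real ((v - 1 - n) div (L + n)) * real L) ^ d))"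
        using measure_nohit_grid_le[OF mM] gm unfolding x_def d_def g_def m_def by (simp only:)
      \<comment> \<open>\<open>B = 2 ^ 2 ^ d\<close> comes from \<open>1 / g \<le> 2\<close> and the
        at most \<open>2 ^ d\<close> blocks near a given position.\<close>
      have "(1 / g) ^ (2 ^ d) \<le> B"
        unfolding B_def using g by (intro power_mono) (simp_all add: field_simps)
      then have "(real M ^ d - (real m * real L) ^ d) * p * (1 / g) ^ (2 ^ d)
          \<le> (real M ^ d - (real m * real L) ^ d) * p * B"
        using mL est(1) by (intro mult_left_mono) auto
      then have "g ^ (m ^ d) * (1 - (real M ^ d - (real m * real L) ^ d) * p * B)
          \<le> g ^ (m ^ d) * (1 - (real M ^ d - (real m * real L) ^ d) * p * (1 / g) ^ (2 ^ d))"
        using g by (intro mult_left_mono) auto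
      also have "\<dots> \<le> x"
        using measure_nohit_grid_ge[OF mM L(1)] g by (simp add: x_def p_def g_def d_def)
      finally show "exp (- (\<Lambda> * p * (real ((v - 1 - n) div (L + n)) * real L) ^ d))
          * (1 - (real (v - 1 - n) ^ d - (real ((v - 1 - n) div (L + n)) * real L) ^ d) * p * B) \<le> x"
        unfolding gm by (simp only: m_def M_def)
    qed (use d L H nH C1 est \<Lambda>1 \<Lambda>_ge \<Lambda>_le v in \<open>simp_all add: x_def B_def\<close>)
    \<comment> \<open>Since \<open>n ^ d \<le> N\<close>, the error \<open>1 / H\<close> becomes
      decay in \<open>n ^ d\<close> with rate \<open>ln 2 / (24 * d)\<close>.\<close>
    also have "\<dots> \<le> C * exp (- (c0 / 2) * t) * exp (- (ln 2 / (24 * real d)) * real n ^ d)"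
    proof -
      have "real n ^ d \<le> real N" unfolding N_eq of_nat_power by (intro power_mono) auto
      then have "ln 2 / (24 * real d) * real n ^ d \<le> ln 2 / (24 * real d) * real N"
        by (intro mult_left_mono) auto
      moreover have "1 / H = exp (- (ln 2 / (24 * real d) * real N))"
        by (simp add: H_def powr_def exp_minus inverse_eq_divide mult_ac)
      ultimately have "1 / H \<le> exp (- (ln 2 / (24 * real d)) * real n ^ d)" by simp
      moreover have "C \<ge> 0" unfolding C_def c0_def D_def F_def B_def using \<Lambda>1 C1
        by (intro add_nonneg_nonneg mult_nonneg_nonneg divide_nonneg_nonneg) auto
      ultimately have "C * exp (- (c0 / 2) * t) * (1 / H)
          \<le> C * exp (- (c0 / 2) * t) * exp (- (ln 2 / (24 * real d)) * real n ^ d)"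
        by (intro mult_left_mono) auto
      then show ?thesis by simp
    qed
    finally show ?thesis unfolding x_eq .
  qed
  with \<Lambda>_ge \<Lambda>_le show ?thesis by blast
qed

theorem theorem2p8:
  fixes Q :: "('d::finite) config measure" and \<epsilon>0 :: real
  assumes dim: "CARD('d) \<ge> 2"
    and gibbs: "is_gibbs Q"
    and stat: "stationary Q"
    and erg: "ergodic Q"
    and eps0: "\<epsilon>0 > 0"
    and R_pos: "\<forall>\<epsilon>. 0 \<le> \<epsilon> \<and> \<epsilon> < \<epsilon>0 \<longrightarrow>
                 (\<exists>r>0. (\<lambda>n. rate_distortion_n Q bernoulli_field \<epsilon> n) \<longlonglongrightarrow> r)"
  shows "\<forall>\<alpha>. 0 < \<alpha> \<and> \<alpha> < 1 \<longrightarrow> (\<exists>\<epsilon>1>0. \<forall>\<epsilon>. 0 < \<epsilon> \<and> \<epsilon> < \<epsilon>1 \<and> \<epsilon> / \<alpha> < \<epsilon>0 \<longrightarrow>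
     (\<exists>\<Lambda>1 \<Lambda>2 C c K. \<Lambda>1 > 0 \<and> \<Lambda>2 > 0 \<and> C > 0 \<and> c > 0 \<and> K > 0 \<and>
       (\<exists>\<Lambda> :: nat \<Rightarrow> 'd config \<Rightarrow> real.
          (\<forall>n A. A \<in> patterns n \<longrightarrow> \<Lambda>1 \<le> \<Lambda> n A \<and> \<Lambda> n A \<le> \<Lambda>2) \<and>
          (\<forall>t>0. \<forall>n\<ge>1. AE \<omega> in Q.
             \<bar>measure bernoulli_field
                {\<sigma> \<in> space bernoulli_field.
                   hit_time n \<epsilon> (restr n \<omega>) \<sigma> >
                   ereal (t / (\<Lambda> n (restr n \<omega>) *
                               measure bernoulli_field (approx_set n \<epsilon> (restr n \<omega>))))}
              - exp (- t)\<bar>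
             \<le> C * exp (- c * t) * exp (- K * real n ^ CARD('d))))))"
proof -
  obtain r0 :: nat where r0: "r0 \<ge> 1"
    "\<And>n. n \<ge> r0 \<Longrightarrow> (2 * real n + 1) ^ CARD('d) * (2 * (9/10) ^ (n + 1)) \<le> 1/2"
    using polynomial_times_geometric_small[of "CARD('d)"] by blast
  define C1 where "C1 = 96 * real CARD('d)"
  define B where "B = (2::real) ^ 2 ^ CARD('d)"
  define \<Lambda>1 where "\<Lambda>1 = (1 / real r0) ^ CARD('d) / 2"
  define c0 where "c0 = (1 / (2 * (1 + C1))) ^ CARD('d)"
  define D where "D = real CARD('d) * (1/2 + C1)"
  define F where "F = (2 * (1 + 2 * C1)) ^ CARD('d)"
  define C where "C = 2 / c0 * (D / \<Lambda>1 * (B + 2)) + 2 * F * exp (c0 * F)"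
  define K where "K = ln 2 / (24 * real CARD('d))"
  define approx where "approx \<epsilon> n A \<Lambda> \<longleftrightarrow> (\<forall>t>0. \<bar>measure bernoulli_field
      {\<sigma> \<in> space bernoulli_field. hit_time n \<epsilon> A \<sigma> >
        ereal (t / (\<Lambda> * measure bernoulli_field (approx_set n \<epsilon> A)))} - exp (- t)\<bar>
      \<le> C * exp (- (c0 / 2) * t) * exp (- K * real n ^ CARD('d)))"
    for \<epsilon> n \<Lambda> and A :: "'d config"
  have C1: "C1 > 0" using dim by (simp add: C1_def)
  have \<Lambda>1: "\<Lambda>1 > 0" "\<Lambda>1 \<le> 2"
    using r0(1) power_le_one[of "1 / real r0" "CARD('d)"] by (simp_all add: \<Lambda>1_def)
  have c0: "c0 > 0" using C1 by (simp add: c0_def)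
  have F: "F > 0" using C1 by (simp add: F_def)
  have "D \<ge> 0" "B \<ge> 0" using C1 by (simp_all add: D_def B_def)
  then have C: "C > 0" unfolding C_def
    using c0 F \<Lambda>1 by (intro add_nonneg_pos mult_pos_pos mult_nonneg_nonneg divide_nonneg_nonneg) auto
  have K: "K > 0" using dim by (simp add: K_def)
  have law: "\<exists>\<Lambda>. \<Lambda>1 \<le> \<Lambda> \<and> \<Lambda> \<le> 2 \<and> (n \<ge> 1 \<longrightarrow> approx \<epsilon> n A \<Lambda>)"
    if "0 < \<epsilon>" "\<epsilon> < 1/1024" for \<epsilon> n and A :: "'d config"
  proof (cases "n \<ge> 1")
    case True
    show ?thesis
      using pattern_exponential_law[OF dim that True r0, of A]
      unfolding approx_def C_def c0_def D_def F_def \<Lambda>1_def B_def C1_def K_def by blast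
  next
    \<comment> \<open>Only \<open>n = 0\<close> remains, where any value between
      \<open>\<Lambda>1\<close> and 2 will do.\<close>
    case False
    then show ?thesis using \<Lambda>1 by auto
  qed
  show ?thesis
  \<comment> \<open>The threshold 1/1024 is the relative radius up to which the estimate for
    overlapping occurrences holds.\<close>
  proof (rule allI, rule impI, rule exI[of _ "1/1024 :: real"], intro conjI allI impI)
    fix \<epsilon> \<alpha> :: real
    assume "0 < \<epsilon> \<and> \<epsilon> < 1/1024 \<and> \<epsilon> / \<alpha> < \<epsilon>0"
    then have "\<forall>n A. \<exists>\<Lambda>. \<Lambda>1 \<le> \<Lambda> \<and> \<Lambda> \<le> 2 \<and> (n \<ge> 1 \<longrightarrow> approx \<epsilon> n (A :: 'd config) \<Lambda>)"
      using law by blast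
    then obtain \<Lambda> where \<Lambda>: "\<And>n A. \<Lambda>1 \<le> \<Lambda> n A \<and> \<Lambda> n A \<le> 2"
      "\<And>n A. n \<ge> 1 \<Longrightarrow> approx \<epsilon> n (A :: 'd config) (\<Lambda> n A)" by metis
    show "\<exists>\<Lambda>1 \<Lambda>2 C c K. \<Lambda>1 > 0 \<and> \<Lambda>2 > 0 \<and> C > 0 \<and> c > 0 \<and> K > 0 \<and>
       (\<exists>\<Lambda> :: nat \<Rightarrow> 'd config \<Rightarrow> real.
          (\<forall>n A. A \<in> patterns n \<longrightarrow> \<Lambda>1 \<le> \<Lambda> n A \<and> \<Lambda> n A \<le> \<Lambda>2) \<and>
          (\<forall>t>0. \<forall>n\<ge>1. AE \<omega> in Q.
             \<bar>measure bernoulli_field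
                {\<sigma> \<in> space bernoulli_field.
                   hit_time n \<epsilon> (restr n \<omega>) \<sigma> >
                   ereal (t / (\<Lambda> n (restr n \<omega>) *
                               measure bernoulli_field (approx_set n \<epsilon> (restr n \<omega>))))}
              - exp (- t)\<bar>
             \<le> C * exp (- c * t) * exp (- K * real n ^ CARD('d))))"
    \<comment> \<open>The law holds for every pattern, so the almost sure bound is shown pointwise,
      at \<open>restr n \<omega>\<close>.\<close>
    proof (rule exI[of _ \<Lambda>1], rule exI[of _ 2], rule exI[of _ C], rule exI[of _ "c0 / 2"],
        rule exI[of _ K], intro conjI exI[of _ \<Lambda>] allI impI AE_I2)
      fix t :: real and n :: nat and \<omega>
      assume "t > 0" "n \<ge> 1"
      then show "\<bar>measure bernoulli_field
          {\<sigma> \<in> space bernoulli_field.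
            hit_time n \<epsilon> (restr n \<omega>) \<sigma> >
            ereal (t / (\<Lambda> n (restr n \<omega>) *
              measure bernoulli_field (approx_set n \<epsilon> (restr n \<omega>))))} - exp (- t)\<bar>
        \<le> C * exp (- (c0 / 2) * t) * exp (- K * real n ^ CARD('d))"
        using \<Lambda>(2)[of n "restr n \<omega>"] unfolding approx_def by blast
    qed (use \<Lambda>(1) \<Lambda>1 C c0 K in simp_all)
  qed simp
qed

end
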